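(* Let $(\underline{Y}_t)_{t\in\mathbb{Z}}$ be the stationary solution of the model $$\underline{Y}_t=A(\underline{\eta}_t)\underline{Y}_{t-1}+\underline{B}(\underline{\eta}_t).$$ Assume $\kappa_2<+\infty$, where $\kappa_k:=E\{\varepsilon_t^{2k}\}$. 1. If $$\rho\left(\prod_{v=0}^{s-1}E\left\{\phi_{s-v}^{\otimes 2}(\underline{\eta}_t)\right\}\right)<1,$$ then $\underline{Y}_t\in\mathbb{L}^2$. 2. Conversely, if $\rho\left(\prod_{v=0}^{s-1}E\left\{\phi_{s-v}^{\otimes 2}(\underline{\eta}_t)\right\}\right)\ge 1$, then there is no strictly stationary solution $(\underline{Y}_t)_{t\in\mathbb{Z}}$ of the model such that $E\{\underline{Y}_t^{\otimes 2}\}<+\infty$.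
   Context: Model. Fix integers $s,p,q\ge 1$ and put $d=p+q$. The periodic GARCH (PGARCH) process $(x_t)_{t\in\mathbb{Z}}$ of period $s$ satisfies, for $t\in\mathbb{Z}$ and $v=1,\dots,s$, $x_{st+v}=\varepsilon_{st+v}\sqrt{h_{st+v}}$ and $h_{st+v}=\alpha_0(v)+\sum_{i=1}^p\alpha_i(v)x_{st+v-i}^2+\sum_{j=1}^q\beta_j(v)h_{st+v-j}$, where $\alpha_0(v)>0$, $\alpha_i(v)\ge 0$, $\beta_j(v)\ge 0$ are constants. The $(\varepsilon_t)_{t\in\mathbb{Z}}$ are i.i.d. real random variables with $E\varepsilon_t=E\varepsilon_t^3=0$ and $E\varepsilon_t^2=1$; $\varepsilon_k$ is independent of $x_t$ for $k>t$. Vector form. Put $y_t=x_t^2$, $\eta_t=\varepsilon_t^2$, $\underline{\eta}_t=(\eta_{st+1},\dots,\eta_{st+s})'\in\mathbb{R}^s$ (an i.i.d. sequence), $\underline{y}_{st+v}=(y_{st+v},\dots,y_{st+v-p+1},h_{st+v},\dots,h_{st+v-q+1})'\in\mathbb{R}^d$ and $\underline{Y}_t=(\underline{y}_{st+1}',\dots,\underline{y}_{st+s}')'\in\mathbb{R}^{ds}$. Since $\underline{Y}_t$ is made of squares $x^2$ and volatilities $h$, solutions $(\underline{Y}_t)$ of the model are understood to have nonnegative components. For $v=1,\dots,s$, $\underline{B}_v(\underline{\eta}_t)\in\mathbb{R}^d$ has first coordinate $\alpha_0(v)\eta_{st+v}$, $(p+1)$-th coordinate $\alpha_0(v)$, and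 all other coordinates $0$; and $\phi_v(\underline{\eta}_t)$ is the $d\times d$ matrix $$\phi_v(\underline{\eta}_t)=\begin{pmatrix} A_v(\underline{\eta}_t) & B_v(\underline{\eta}_t) \\ A_v & B_v \end{pmatrix},$$ where: $A_v(\underline{\eta}_t)$ is the $p\times p$ matrix with first row $(\alpha_1(v)\eta_{st+v},\dots,\alpha_p(v)\eta_{st+v})$, ones on the first subdiagonal and zeros elsewhere; $B_v(\underline{\eta}_t)$ is the $p\times q$ matrix with first row $(\beta_1(v)\eta_{st+v},\dots,\beta_q(v)\eta_{st+v})$ and zeros elsewhere; $A_v$ is the $q\times p$ matrix with first row $(\alpha_1(v),\dots,\alpha_p(v))$ and zeros elsewhere; $B_v$ is the $q\times q$ matrix with first row $(\beta_1(v),\dots,\beta_q(v))$, ones on the first subdiagonal and zeros elsewhere. Products $\prod_{j=a}^{b}M_j$ of matrices are ordered $M_aM_{a+1}\cdots M_b$; empty products are identity matrices. $\rho(\cdot)$ is the spectral radius, and $M^{\otimes m}=M\otimes\cdots\otimes M$ ($m$ times) is the Kronecker power. $A(\underline{\eta}_t)$ is the $ds\times ds$ matrix, in $d\times d$ blocks, whose first $s-1$ block columns are zero and whose last block column has $v$-th block $\phi_v(\underline{\eta}_t)\cdots\phi_1(\underline{\eta}_t)$, $v=1,\dots,s$. $\underline{B}(\underline{\eta}_t)\in\mathbb{R}^{ds}$ has $v$-th block $\sum_{k=1}^{v}\{\prod_{i=0}^{v-k-1}\phi_{v-i}(\underline{\eta}_t)\}\underline{B}_k(\underline{\eta}_t)$,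 $v=1,\dots,s$. $\underline{Y}_t\in\mathbb{L}^2$ means $E\|\underline{Y}_t\|^2<\infty$; $E\{\underline{Y}_t^{\otimes 2}\}<+\infty$ means all components are finite. *)

theory Defs
  imports "HOL-Probability.Probability" "Jordan_Normal_Form.Spectral_Radius"
begin

section \<open>Matrix operations\<close>

definition mat_prod :: "nat \<Rightarrow> real mat list \<Rightarrow> real mat" where
  "mat_prod n Ms = foldr (*) Ms (1\<^sub>m n)"

definition kron_mat :: "real mat \<Rightarrow> real mat \<Rightarrow> real mat" where
  "kron_mat A B = mat (dim_row A * dim_row B) (dim_col A * dim_col B)
     (\<lambda>(i, j). A $$ (i div dim_row B, j div dim_col B) * B $$ (i mod dim_row B, j mod dim_col B))"

primrec kron_mat_power :: "real mat \<Rightarrow> nat \<Rightarrow> real mat" where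
  "kron_mat_power A 0 = 1\<^sub>m 1"
| "kron_mat_power A (Suc m) = kron_mat A (kron_mat_power A m)"

definition kron_vec :: "real vec \<Rightarrow> real vec \<Rightarrow> real vec" where
  "kron_vec v w = vec (dim_vec v * dim_vec w) (\<lambda>i. v $ (i div dim_vec w) * w $ (i mod dim_vec w))"

primrec kron_vec_power :: "real vec \<Rightarrow> nat \<Rightarrow> real vec" where
  "kron_vec_power v 0 = vec 1 (\<lambda>_. 1)"
| "kron_vec_power v (Suc m) = kron_vec v (kron_vec_power v m)"

text \<open>Eigenvalues of a real matrix are taken in the complex numbers.\<close>

definition real_spectral_radius :: "real mat \<Rightarrow> real" where
  "real_spectral_radius A = spectral_radius (map_mat complex_of_real A)"


section \<open>Coefficient matrices of the PGARCH recursion\<close>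

text \<open>The coefficients are written \<open>\<alpha>0 v\<close>, \<open>\<alpha> i v\<close> and \<open>\<beta> j v\<close> with \<open>v\<close> in \<open>{1..s}\<close>, \<open>i\<close> in \<open>{1..p}\<close>
  and \<open>j\<close> in \<open>{1..q}\<close>. Vectors and matrices are indexed from 0, so the \<open>v\<close>-th coordinate of the
  vector \<open>e\<close> of squared innovations is \<open>e $ (v - 1)\<close>.\<close>

definition pgarch_eta :: "nat \<Rightarrow> (int \<Rightarrow> 'a \<Rightarrow> real) \<Rightarrow> int \<Rightarrow> 'a \<Rightarrow> real vec" where
  "pgarch_eta s \<epsilon> t \<omega> = vec s (\<lambda>i. (\<epsilon> (int s * t + int (i + 1)) \<omega>)\<^sup>2)"

definition pgarch_phi ::
  "nat \<Rightarrow> nat \<Rightarrow> (nat \<Rightarrow> nat \<Rightarrow> real) \<Rightarrow> (nat \<Rightarrow> nat \<Rightarrow> real) \<Rightarrow> nat \<Rightarrow> real vec \<Rightarrow> real mat" where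
  "pgarch_phi p q \<alpha> \<beta> v e = four_block_mat
     (mat p p (\<lambda>(i, j). if i = 0 then \<alpha> (j + 1) v * e $ (v - 1) else if i = j + 1 then 1 else 0))
     (mat p q (\<lambda>(i, j). if i = 0 then \<beta> (j + 1) v * e $ (v - 1) else 0))
     (mat q p (\<lambda>(i, j). if i = 0 then \<alpha> (j + 1) v else 0))
     (mat q q (\<lambda>(i, j). if i = 0 then \<beta> (j + 1) v else if i = j + 1 then 1 else 0))"

definition pgarch_b :: "nat \<Rightarrow> nat \<Rightarrow> (nat \<Rightarrow> real) \<Rightarrow> nat \<Rightarrow> real vec \<Rightarrow> real vec" where
  "pgarch_b p q \<alpha>0 v e = vec (p + q)
     (\<lambda>i. if i = 0 then \<alpha>0 v * e $ (v - 1) else if i = p then \<alpha>0 v else 0)"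

text \<open>The product \<open>\<phi>\<^sub>v \<phi>\<^bsub>v-1\<^esub> \<cdots> \<phi>\<^bsub>k+1\<^esub>\<close>, which has \<open>v - k\<close> factors.\<close>

definition pgarch_phi_prod ::
  "nat \<Rightarrow> nat \<Rightarrow> (nat \<Rightarrow> nat \<Rightarrow> real) \<Rightarrow> (nat \<Rightarrow> nat \<Rightarrow> real) \<Rightarrow> nat \<Rightarrow> nat \<Rightarrow> real vec \<Rightarrow> real mat" where
  "pgarch_phi_prod p q \<alpha> \<beta> v k e =
     mat_prod (p + q) (map (\<lambda>i. pgarch_phi p q \<alpha> \<beta> (v - i) e) [0..<v - k])"

text \<open>Row or column \<open>i\<close> of an object made of blocks of size \<open>d\<close> lies in block number
  \<open>i div d + 1\<close>, at position \<open>i mod d\<close>.\<close>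

definition pgarch_A ::
  "nat \<Rightarrow> nat \<Rightarrow> nat \<Rightarrow> (nat \<Rightarrow> nat \<Rightarrow> real) \<Rightarrow> (nat \<Rightarrow> nat \<Rightarrow> real) \<Rightarrow> real vec \<Rightarrow> real mat" where
  "pgarch_A s p q \<alpha> \<beta> e = (let d = p + q in mat (d * s) (d * s)
     (\<lambda>(i, j). if j div d + 1 = s
        then pgarch_phi_prod p q \<alpha> \<beta> (i div d + 1) 0 e $$ (i mod d, j mod d) else 0))"

definition pgarch_B ::
  "nat \<Rightarrow> nat \<Rightarrow> nat \<Rightarrow> (nat \<Rightarrow> real) \<Rightarrow> (nat \<Rightarrow> nat \<Rightarrow> real) \<Rightarrow> (nat \<Rightarrow> nat \<Rightarrow> real) \<Rightarrow> real vec \<Rightarrow> real vec"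
  where
  "pgarch_B s p q \<alpha>0 \<alpha> \<beta> e = (let d = p + q in vec (d * s)
     (\<lambda>i. let v = i div d + 1 in
        \<Sum>k = 1..v. (pgarch_phi_prod p q \<alpha> \<beta> v k e *\<^sub>v pgarch_b p q \<alpha>0 k e) $ (i mod d)))"


section \<open>Random vectors and strictly stationary solutions\<close>

definition random_vec :: "'a measure \<Rightarrow> nat \<Rightarrow> ('a \<Rightarrow> real vec) \<Rightarrow> bool" where
  "random_vec M n X \<longleftrightarrow> (\<forall>\<omega>\<in>space M. X \<omega> \<in> carrier_vec n) \<and>
     (\<forall>i<n. (\<lambda>\<omega>. X \<omega> $ i) \<in> borel_measurable M)"

text \<open>Finite-dimensional distributions are laws on products of copies of the real line, indexed by
  pairs of a time and a coordinate.\<close>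

definition strictly_stationary :: "'a measure \<Rightarrow> nat \<Rightarrow> (int \<Rightarrow> 'a \<Rightarrow> real vec) \<Rightarrow> bool" where
  "strictly_stationary M n Y \<longleftrightarrow> (\<forall>T h. finite T \<longrightarrow>
     distr M (Pi\<^sub>M (T \<times> {..<n}) (\<lambda>_. borel)) (\<lambda>\<omega>. restrict (\<lambda>(t, i). Y (t + h) \<omega> $ i) (T \<times> {..<n})) =
     distr M (Pi\<^sub>M (T \<times> {..<n}) (\<lambda>_. borel)) (\<lambda>\<omega>. restrict (\<lambda>(t, i). Y t \<omega> $ i) (T \<times> {..<n})))"

text \<open>The volatility \<open>h\<^bsub>st+v\<^esub>\<close> is coordinate \<open>p + 1\<close> of the \<open>v\<close>-th block of \<open>Y t\<close>; for
  \<open>n = st + v\<close> with \<open>v\<close> in \<open>{1..s}\<close> one has \<open>t = (n - 1) div s\<close> and \<open>v - 1 = (n - 1) mod s\<close>.\<close>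

definition pgarch_h ::
  "nat \<Rightarrow> nat \<Rightarrow> nat \<Rightarrow> (int \<Rightarrow> 'a \<Rightarrow> real vec) \<Rightarrow> int \<Rightarrow> 'a \<Rightarrow> real" where
  "pgarch_h s p q Y n \<omega> = Y ((n - 1) div int s) \<omega> $ (nat ((n - 1) mod int s) * (p + q) + p)"

definition pgarch_x ::
  "nat \<Rightarrow> nat \<Rightarrow> nat \<Rightarrow> (int \<Rightarrow> 'a \<Rightarrow> real) \<Rightarrow> (int \<Rightarrow> 'a \<Rightarrow> real vec) \<Rightarrow> int \<Rightarrow> 'a \<Rightarrow> real" where
  "pgarch_x s p q \<epsilon> Y n \<omega> = \<epsilon> n \<omega> * sqrt (pgarch_h s p q Y n \<omega>)"

definition pgarch_solution ::
  "'a measure \<Rightarrow> nat \<Rightarrow> nat \<Rightarrow> nat \<Rightarrow> (nat \<Rightarrow> real) \<Rightarrow> (nat \<Rightarrow> nat \<Rightarrow> real) \<Rightarrow> (nat \<Rightarrow> nat \<Rightarrow> real) \<Rightarrow>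
   (int \<Rightarrow> 'a \<Rightarrow> real) \<Rightarrow> (int \<Rightarrow> 'a \<Rightarrow> real vec) \<Rightarrow> bool" where
  "pgarch_solution M s p q \<alpha>0 \<alpha> \<beta> \<epsilon> Y \<longleftrightarrow>
     (\<forall>t. random_vec M ((p + q) * s) (Y t)) \<and>
     (\<forall>t. AE \<omega> in M. \<forall>i<(p + q) * s. 0 \<le> Y t \<omega> $ i) \<and>
     (\<forall>t. AE \<omega> in M. Y t \<omega> =
        pgarch_A s p q \<alpha> \<beta> (pgarch_eta s \<epsilon> t \<omega>) *\<^sub>v Y (t - 1) \<omega>
          + pgarch_B s p q \<alpha>0 \<alpha> \<beta> (pgarch_eta s \<epsilon> t \<omega>)) \<and>
     (\<forall>t k. t < k \<longrightarrow> prob_space.indep_var M borel (\<epsilon> k) borel (pgarch_x s p q \<epsilon> Y t))"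


section \<open>Moments\<close>

definition kappa :: "'a measure \<Rightarrow> ('a \<Rightarrow> real) \<Rightarrow> nat \<Rightarrow> ennreal" where
  "kappa M X k = (\<integral>\<^sup>+\<omega>. ennreal (X \<omega> ^ (2 * k)) \<partial>M)"

definition expect_mat :: "'a measure \<Rightarrow> nat \<Rightarrow> ('a \<Rightarrow> real mat) \<Rightarrow> real mat" where
  "expect_mat M n X = mat n n (\<lambda>ij. \<integral>\<omega>. X \<omega> $$ ij \<partial>M)"

definition pgarch_moment_mat ::
  "'a measure \<Rightarrow> nat \<Rightarrow> nat \<Rightarrow> nat \<Rightarrow> (nat \<Rightarrow> nat \<Rightarrow> real) \<Rightarrow> (nat \<Rightarrow> nat \<Rightarrow> real) \<Rightarrow>
   (int \<Rightarrow> 'a \<Rightarrow> real) \<Rightarrow> nat \<Rightarrow> int \<Rightarrow> real mat" where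
  "pgarch_moment_mat M s p q \<alpha> \<beta> \<epsilon> m t = (let n = (p + q) ^ m in mat_prod n
     (map (\<lambda>v. expect_mat M n
            (\<lambda>\<omega>. kron_mat_power (pgarch_phi p q \<alpha> \<beta> (s - v) (pgarch_eta s \<epsilon> t \<omega>)) m))
        [0..<s]))"

definition in_L2 :: "'a measure \<Rightarrow> nat \<Rightarrow> ('a \<Rightarrow> real vec) \<Rightarrow> bool" where
  "in_L2 M n X \<longleftrightarrow> random_vec M n X \<and> integrable M (\<lambda>\<omega>. \<Sum>i<n. (X \<omega> $ i)\<^sup>2)"

definition finite_kron_moment :: "'a measure \<Rightarrow> nat \<Rightarrow> ('a \<Rightarrow> real vec) \<Rightarrow> nat \<Rightarrow> bool" where
  "finite_kron_moment M n X m \<longleftrightarrow> (\<forall>i<n ^ m. integrable M (\<lambda>\<omega>. kron_vec_power (X \<omega>) m $ i))"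

end

theory Submission
  imports Defs
begin

text \<open>
  Season by season, the model is an affine recursion \<open>y\<^sub>n = \<phi>\<^sub>n y\<^bsub>n-1\<^esub> + b\<^sub>n\<close> in dimension \<open>d = p + q\<close>
  with nonnegative coefficients, where \<open>\<phi>\<^sub>n\<close> and \<open>b\<^sub>n\<close> depend on the innovation \<open>\<epsilon>\<^sub>n\<close> alone. Unrolled
  over \<open>k\<close> steps it reads \<open>y\<^sub>n = S k n + T k n y\<^bsub>n-k\<^esub>\<close>, where the partial sum \<open>S k n\<close> and the linear map
  \<open>T k n = \<phi>\<^sub>n \<cdots> \<phi>\<^bsub>n-k+1\<^esub>\<close> depend on the innovations \<open>\<epsilon>\<^bsub>n-k+1\<^esub>, \<dots>, \<epsilon>\<^sub>n\<close> alone. If \<open>z\<close> is a function of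
  the innovations before time \<open>n\<close>, then the second moments satisfy
  \<open>E (\<phi>\<^sub>n z)\<^sup>2 = E (\<phi>\<^sub>n\<^sup>2) E (z\<^sup>2)\<close> with Kronecker squares (\<open>mom_step\<close>). Over \<open>k\<close> full periods they are
  therefore multiplied by the \<open>k\<close>-th power of the matrix whose spectral radius appears in the
  theorem (\<open>mom_T\<close>). This is applied to the partial sums and to the columns of \<open>T\<close>, never to the
  solution itself.

  If the spectral radius is less than 1, the powers decay geometrically, and some \<open>T L n\<close> with
  \<open>L\<close> a multiple of \<open>s\<close> reduces the total second moment by a factor 4, for all \<open>n\<close> (\<open>contraction\<close>).
  Hence the partial sums \<open>S (L k) n\<close> are bounded in mean square (\<open>V_S_multiples_bounded\<close>), and the
  entries of \<open>T (L k) n\<close> tend to 0 in mean square. By stationarity the law of \<open>y\<^bsub>n-Lk\<^esub>\<close> does not depend on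
  \<open>k\<close>, so the remainder \<open>T (L k) n y\<^bsub>n-Lk\<^esub>\<close> tends to 0 in probability, and \<open>y\<^sub>n\<close> inherits the mean square
  bound (\<open>square_integrable_limit_in_probability\<close>).

  Conversely, nonnegativity gives \<open>y\<^sub>n \<ge> S k n\<close>, so finite second moments of \<open>y\<^sub>n\<close> bound those of all
  \<open>S k n\<close>. After \<open>d\<close> steps each partial sum has second moments bounded below by a positive constant,
  because the subdiagonal ones in \<open>\<phi>\<^sub>n\<close> spread the offsets \<open>\<alpha>\<^sub>0\<close> to all coordinates (\<open>mom_S_ge\<close>).
  Splitting \<open>S\<close> into blocks of \<open>s d\<close> steps shows that the powers of the moment matrix,
  taken along multiples of \<open>d\<close> and applied to the all-ones vector, form a convergent series
  (\<open>mom_S_ge_sum\<close>). They tend to 0, which excludes an eigenvalue of modulus at least 1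
  (\<open>real_spectral_radius_less_1I\<close>).
\<close>

section \<open>Powers of matrices and the spectral radius\<close>

lemma spectral_radius_smult:
  assumes A: "A \<in> carrier_mat n n" and n: "n > 0" and c: "c > 0"
  shows "spectral_radius (complex_of_real c \<cdot>\<^sub>m A) \<le> c * spectral_radius A"
proof -
  let ?B = "complex_of_real c \<cdot>\<^sub>m A"
  have B: "?B \<in> carrier_mat n n" using A by simp
  obtain ev where ev: "ev \<in> spectrum ?B" and norm: "spectral_radius ?B = norm ev"
    using spectral_radius_mem_max(1)[OF B n] by auto
  from ev obtain v where v: "v \<in> carrier_vec n" "v \<noteq> 0\<^sub>v n" "?B *\<^sub>v v = ev \<cdot>\<^sub>v v"
    using B unfolding spectrum_def eigenvalue_def eigenvector_def by auto
  have "A *\<^sub>v v = (ev / complex_of_real c) \<cdot>\<^sub>v v"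
  proof (rule eq_vecI)
    fix i assume "i < dim_vec ((ev / complex_of_real c) \<cdot>\<^sub>v v)"
    then have i: "i < n" using v by simp
    have "complex_of_real c * (A *\<^sub>v v) $ i = ev * v $ i"
      using arg_cong[OF v(3), of "\<lambda>w. w $ i"] i v(1) A
      by (simp add: row_smult)
    then show "(A *\<^sub>v v) $ i = ((ev / complex_of_real c) \<cdot>\<^sub>v v) $ i"
      using i v(1) c by (simp add: field_simps)
  qed (use A v in auto)
  then have "ev / complex_of_real c \<in> spectrum A"
    unfolding spectrum_def eigenvalue_def eigenvector_def using A v by auto
  then have "norm (ev / complex_of_real c) \<le> spectral_radius A"
    using spectral_radius_mem_max(2)[OF A n] by blast
  then show ?thesis using c norm by (simp add: norm_divide field_simps)
qed

lemma pow_mat_smult: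
  assumes A: "(A :: complex mat) \<in> carrier_mat n n"
  shows "(c \<cdot>\<^sub>m A) ^\<^sub>m k = c ^ k \<cdot>\<^sub>m (A ^\<^sub>m k)"
proof (induction k)
  case 0
  show ?case using A by auto
next
  case (Suc k)
  have Ak: "A ^\<^sub>m k \<in> carrier_mat n n" using A by simp
  have "(c \<cdot>\<^sub>m A) ^\<^sub>m Suc k = (c ^ k \<cdot>\<^sub>m (A ^\<^sub>m k)) * (c \<cdot>\<^sub>m A)"
    by (simp add: Suc)
  also have "\<dots> = c ^ k \<cdot>\<^sub>m ((A ^\<^sub>m k) * (c \<cdot>\<^sub>m A))"
    by (rule mult_smult_assoc_mat[OF Ak, of _ n]) (use A in auto)
  also have "(A ^\<^sub>m k) * (c \<cdot>\<^sub>m A) = c \<cdot>\<^sub>m ((A ^\<^sub>m k) * A)"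
    by (rule mult_smult_distrib[OF Ak A])
  finally show ?case by (auto simp: mult_ac)
qed

text \<open>A matrix whose spectral radius is less than 1 has bounded powers. Applied to \<open>A / r\<close> for some \<open>r\<close>
  strictly between the spectral radius and 1, this gives geometric decay.\<close>

lemma real_spectral_radius_less_1_bound:
  fixes A :: "real mat"
  assumes A: "A \<in> carrier_mat n n" and n: "n > 0" and less: "real_spectral_radius A < 1"
  obtains c r where "c \<ge> 0" "0 < r" "r < 1"
    "\<And>k i j. i < n \<Longrightarrow> j < n \<Longrightarrow> \<bar>(A ^\<^sub>m k) $$ (i, j)\<bar> \<le> c * r ^ k"
proof -
  let ?A = "map_mat complex_of_real A"
  have CA: "?A \<in> carrier_mat n n" using A by simp
  have sr: "spectral_radius ?A < 1" using less unfolding real_spectral_radius_def .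
  define r where "r = (max (spectral_radius ?A) 0 + 1) / 2"
  have r: "0 < r" "r < 1" "spectral_radius ?A < r"
    using sr unfolding r_def by (auto simp: max_def)
  let ?B = "complex_of_real (1 / r) \<cdot>\<^sub>m ?A"
  have B: "?B \<in> carrier_mat n n" using A by simp
  have "spectral_radius ?B \<le> 1 / r * spectral_radius ?A"
    by (rule spectral_radius_smult[OF CA n]) (use r in simp)
  also have "\<dots> < 1" using r by (simp add: field_simps)
  finally obtain c where c: "\<And>k. norm_bound (?B ^\<^sub>m k) c"
    using spectral_radius_jnf_norm_bound_less_1_upper_triangular[OF B] by blast
  have bound: "\<bar>(A ^\<^sub>m k) $$ (i, j)\<bar> \<le> c * r ^ k" if ij: "i < n" "j < n" for k i j
  proof -
    have "?B ^\<^sub>m k = complex_of_real (1 / r) ^ k \<cdot>\<^sub>m (?A ^\<^sub>m k)"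
      by (rule pow_mat_smult[OF CA])
    also have "?A ^\<^sub>m k = map_mat complex_of_real (A ^\<^sub>m k)"
      by (rule of_real_hom.mat_hom_pow[OF A, symmetric])
    finally have eq: "?B ^\<^sub>m k = complex_of_real (1 / r) ^ k \<cdot>\<^sub>m map_mat complex_of_real (A ^\<^sub>m k)" .
    have dim: "dim_row (A ^\<^sub>m k) = n" "dim_col (A ^\<^sub>m k) = n" using A by auto
    have "(?B ^\<^sub>m k) $$ (i, j) = complex_of_real ((1 / r) ^ k * (A ^\<^sub>m k) $$ (i, j))"
      unfolding eq using ij dim by (simp del: pow_mat_dim)
    moreover have "norm ((?B ^\<^sub>m k) $$ (i, j)) \<le> c"
      using c[of k] ij dim unfolding norm_bound_def eq by auto
    ultimately have "(1 / r) ^ k * \<bar>(A ^\<^sub>m k) $$ (i, j)\<bar> \<le> c"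
      using r by (simp only: norm_of_real)
    then show ?thesis using r by (simp add: field_simps)
  qed
  have "0 \<le> c"
    using bound[of 0 0 0] n A by simp
  then show ?thesis using that[OF _ r(1,2)] bound by blast
qed

text \<open>If the powers of a nonnegative matrix \<open>A\<close> tend to \<open>0\<close> along some sequence of exponents when applied to the
  all-ones vector, then \<open>A\<close> has no eigenvalue outside the open unit_state disc: an eigenvector is
  dominated by a multiple of the all-ones vector.\<close>

lemma real_spectral_radius_less_1I:
  fixes A :: "real mat"
  assumes A: "A \<in> carrier_mat n n" and n: "n > 0"
    and nonneg: "\<And>k i j. i < n \<Longrightarrow> j < n \<Longrightarrow> (A ^\<^sub>m k) $$ (i, j) \<ge> 0"
    and lim: "\<And>i. i < n \<Longrightarrow> (\<lambda>l. \<Sum>j<n. (A ^\<^sub>m (f l)) $$ (i, j)) \<longlonglongrightarrow> 0"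
  shows "real_spectral_radius A < 1"
proof (rule ccontr)
  let ?A = "map_mat complex_of_real A"
  have CA: "?A \<in> carrier_mat n n" using A by simp
  assume "\<not> real_spectral_radius A < 1"
  then have ge: "spectral_radius ?A \<ge> 1" unfolding real_spectral_radius_def by simp
  obtain ev where "ev \<in> spectrum ?A" and ev: "norm ev \<ge> 1"
    using spectral_radius_mem_max(1)[OF CA n] ge by auto
  then obtain v where ev2: "eigenvector ?A v ev"
    unfolding spectrum_def eigenvalue_def by auto
  then have v: "v \<in> carrier_vec n" "v \<noteq> 0\<^sub>v n" using CA unfolding eigenvector_def by auto
  define R where "R = (\<Sum>j<n. norm (v $ j))"
  have R: "norm (v $ j) \<le> R" if "j < n" for j
    unfolding R_def using that by (intro member_le_sum) auto
  have *: "norm (v $ i) \<le> R * (\<Sum>j<n. (A ^\<^sub>m k) $$ (i, j))" if i: "i < n" for i k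
  proof -
    have Ak: "dim_row (A ^\<^sub>m k) = n" "dim_col (A ^\<^sub>m k) = n" using A by auto
    have "(?A ^\<^sub>m k) *\<^sub>v v = ev ^ k \<cdot>\<^sub>v v"
      by (rule eigenvector_pow[OF CA ev2])
    then have "ev ^ k * v $ i = ((?A ^\<^sub>m k) *\<^sub>v v) $ i" using i v by simp
    also have "?A ^\<^sub>m k = map_mat complex_of_real (A ^\<^sub>m k)"
      by (rule of_real_hom.mat_hom_pow[OF A, symmetric])
    also have "(map_mat complex_of_real (A ^\<^sub>m k) *\<^sub>v v) $ i
       = (\<Sum>j<n. complex_of_real ((A ^\<^sub>m k) $$ (i, j)) * v $ j)"
      using i v Ak by (simp add: scalar_prod_def lessThan_atLeast0 del: pow_mat_dim)
    finally have "norm (ev ^ k * v $ i) \<le> (\<Sum>j<n. norm (complex_of_real ((A ^\<^sub>m k) $$ (i, j)) * v $ j))"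
      by (simp add: norm_sum)
    also have "\<dots> \<le> (\<Sum>j<n. (A ^\<^sub>m k) $$ (i, j) * R)"
      using R nonneg i by (intro sum_mono) (auto simp: norm_mult abs_of_nonneg intro!: mult_left_mono)
    finally have "norm ev ^ k * norm (v $ i) \<le> R * (\<Sum>j<n. (A ^\<^sub>m k) $$ (i, j))"
      by (simp add: norm_mult norm_power sum_distrib_left mult.commute)
    moreover have "1 * norm (v $ i) \<le> norm ev ^ k * norm (v $ i)"
      using ev by (intro mult_right_mono) (auto intro: one_le_power)
    ultimately show ?thesis by linarith
  qed
  have "v $ i = 0" if i: "i < n" for i
  proof -
    have "(\<lambda>l. R * (\<Sum>j<n. (A ^\<^sub>m (f l)) $$ (i, j))) \<longlonglongrightarrow> R * 0"
      by (intro tendsto_intros lim i)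
    then have "norm (v $ i) \<le> R * 0"
      by (rule LIMSEQ_le_const) (use *[OF i] in blast)
    then show ?thesis by simp
  qed
  then have "v = 0\<^sub>v n" using v by (intro eq_vecI) auto
  then show False using v by simp
qed

lemma pow_mat_nonneg:
  fixes A :: "real mat"
  assumes A: "A \<in> carrier_mat n n" and nonneg: "\<And>i j. i < n \<Longrightarrow> j < n \<Longrightarrow> A $$ (i, j) \<ge> 0"
  shows "i < n \<Longrightarrow> j < n \<Longrightarrow> (A ^\<^sub>m k) $$ (i, j) \<ge> 0"
proof (induction k arbitrary: i j)
  case 0
  then show ?case using A by simp
next
  case (Suc k)
  have "A ^\<^sub>m k \<in> carrier_mat n n" using A by simp
  then show ?case using Suc A nonneg by (auto simp: scalar_prod_def intro!: sum_nonneg)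
qed

section \<open>Block indices, Kronecker squares and matrix products\<close>

lemma sum_div_mod:
  fixes f :: "nat \<Rightarrow> nat \<Rightarrow> 'b::comm_monoid_add"
  shows "(\<Sum>J<m * n. f (J div n) (J mod n)) = (\<Sum>j<m. \<Sum>l<n. f j l)"
proof -
  have "(\<Sum>J<m * n. f (J div n) (J mod n)) = (\<Sum>j<m. \<Sum>J = j * n..<j * n + n. f (J div n) (J mod n))"
    by (rule sum.nat_group[symmetric])
  also have "\<dots> = (\<Sum>j<m. \<Sum>l<n. f j l)"
  proof (rule sum.cong[OF refl])
    fix j
    have "(\<Sum>J = j * n..<j * n + n. f (J div n) (J mod n)) = (\<Sum>l<n. f ((l + j * n) div n) ((l + j * n) mod n))"
      using sum.shift_bounds_nat_ivl[of "\<lambda>J. f (J div n) (J mod n)" 0 "j * n" n]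
      by (simp add: lessThan_atLeast0 add.commute)
    also have "\<dots> = (\<Sum>l<n. f j l)" by (intro sum.cong) auto
    finally show "(\<Sum>J = j * n..<j * n + n. f (J div n) (J mod n)) = (\<Sum>l<n. f j l)" .
  qed
  finally show ?thesis .
qed

lemma square_index:
  assumes "a < n" "b < (n :: nat)"
  shows "a * n + b < n * n" "(a * n + b) div n = a" "(a * n + b) mod n = b"
proof -
  have "a * n + b < Suc a * n" using assms by simp
  also have "\<dots> \<le> n * n" using assms by (intro mult_le_mono1) auto
  finally show "a * n + b < n * n" .
  have "n \<noteq> 0" using assms by linarith
  then show "(a * n + b) div n = a" "(a * n + b) mod n = b"
    using assms(2) by (simp_all only: div_mult_self3 mod_mult_self3 div_less mod_less add_0_right not_False_eq_True)
qed

lemma kron_mat_power_2: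
  assumes A: "A \<in> carrier_mat d d" and i: "i < d * d" and j: "j < d * d"
  shows "kron_mat_power A 2 $$ (i, j) = A $$ (i div d, j div d) * A $$ (i mod d, j mod d)"
proof -
  have "d > 0" using i by (cases d) auto
  then have lt: "i mod d < d" "j mod d < d" by auto
  have "kron_mat A (1\<^sub>m 1) $$ (i mod d, j mod d) = A $$ (i mod d, j mod d)"
    using A lt by (simp add: kron_mat_def)
  then show ?thesis using A i j
    by (simp add: numeral_2_eq_2) (simp add: kron_mat_def)
qed

lemma kron_vec_power_2:
  assumes v: "dim_vec v = n" and a: "a < n" and b: "b < n"
  shows "kron_vec_power v 2 $ (a * n + b) = v $ a * v $ b"
proof -
  note lt = square_index(1)[OF a b]
  have "kron_vec v (vec 1 (\<lambda>_. 1)) $ b = v $ b"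
    using v b by (simp add: kron_vec_def)
  then show ?thesis using v lt b
    by (simp add: numeral_2_eq_2) (simp add: kron_vec_def)
qed

lemma mat_prod_Nil [simp]: "mat_prod n [] = 1\<^sub>m n"
  and mat_prod_Cons [simp]: "mat_prod n (A # As) = A * mat_prod n As"
  by (simp_all add: mat_prod_def)

lemma mat_prod_carrier:
  assumes "\<And>A. A \<in> set As \<Longrightarrow> A \<in> carrier_mat n n"
  shows "mat_prod n As \<in> carrier_mat n n"
  using assms by (induction As) (auto intro!: mult_carrier_mat)

section \<open>Integrability and convergence in probability\<close>

lemma integrable_mult_of_squares:
  fixes f g :: "'a \<Rightarrow> real"
  assumes [measurable]: "f \<in> borel_measurable M" "g \<in> borel_measurable M"
    and "integrable M (\<lambda>\<omega>. (f \<omega>)\<^sup>2)" "integrable M (\<lambda>\<omega>. (g \<omega>)\<^sup>2)"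
  shows "integrable M (\<lambda>\<omega>. f \<omega> * g \<omega>)"
proof (rule Bochner_Integration.integrable_bound)
  show "integrable M (\<lambda>\<omega>. (f \<omega>)\<^sup>2 + (g \<omega>)\<^sup>2)" using assms by simp
  have "\<bar>a * b\<bar> \<le> a\<^sup>2 + b\<^sup>2" for a b :: real
  proof -
    have "2 * \<bar>a * b\<bar> \<le> a\<^sup>2 + b\<^sup>2"
      using sum_squares_bound[of "\<bar>a\<bar>" "\<bar>b\<bar>"] by (simp add: abs_mult)
    then show ?thesis using abs_ge_zero[of "a * b"] by linarith
  qed
  then show "AE \<omega> in M. norm (f \<omega> * g \<omega>) \<le> norm ((f \<omega>)\<^sup>2 + (g \<omega>)\<^sup>2)"
    by auto
qed measurable

lemma (in prob_space) tight:
  fixes W :: "'a \<Rightarrow> real"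
  assumes [measurable]: "W \<in> borel_measurable M" and "r > 0"
  obtains N :: nat where "N \<ge> 1" "prob {\<omega> \<in> space M. \<bar>W \<omega>\<bar> > real N} < r"
proof -
  let ?A = "\<lambda>N::nat. {\<omega> \<in> space M. \<bar>W \<omega>\<bar> > real N}"
  have "(\<lambda>N. prob (?A N)) \<longlonglongrightarrow> prob (\<Inter>N. ?A N)"
    by (rule finite_Lim_measure_decseq) (auto simp: decseq_def)
  moreover have "(\<Inter>N. ?A N) = {}"
  proof -
    have "\<exists>N. \<not> \<bar>W \<omega>\<bar> > real N" for \<omega>
      using real_arch_simple[of "\<bar>W \<omega>\<bar>"] by (auto simp: not_less)
    then show ?thesis by blast
  qed
  ultimately have "(\<lambda>N. prob (?A N)) \<longlonglongrightarrow> 0" by simp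
  then have "eventually (\<lambda>N. prob (?A N) < r) sequentially"
    using \<open>r > 0\<close> by (rule order_tendstoD)
  then have "eventually (\<lambda>N. prob (?A N) < r \<and> N \<ge> 1) sequentially"
    using eventually_ge_at_top by (rule eventually_conj)
  then show ?thesis using that by (auto simp: eventually_sequentially)
qed

text \<open>The factors \<open>W k\<close> have the same law, hence are uniformly tight, and \<open>U k\<close> tends to 0 in mean square;
  no independence is needed.\<close>

lemma (in prob_space) product_tendsto_0_in_probability:
  fixes U W :: "nat \<Rightarrow> 'a \<Rightarrow> real"
  assumes U [measurable]: "\<And>k. U k \<in> borel_measurable M"
    and U2: "\<And>k. integrable M (\<lambda>\<omega>. (U k \<omega>)\<^sup>2)"
    and lim: "(\<lambda>k. expectation (\<lambda>\<omega>. (U k \<omega>)\<^sup>2)) \<longlonglongrightarrow> 0"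
    and W [measurable]: "\<And>k. W k \<in> borel_measurable M"
    and law: "\<And>k. distr M borel (W k) = distr M borel (W 0)"
    and c: "c > 0"
  shows "(\<lambda>k. prob {\<omega> \<in> space M. \<bar>U k \<omega> * W k \<omega>\<bar> > c}) \<longlonglongrightarrow> 0"
proof (rule LIMSEQ_I)
  fix r :: real assume r: "0 < r"
  obtain N :: nat where N: "N \<ge> 1" "prob {\<omega> \<in> space M. \<bar>W 0 \<omega>\<bar> > real N} < r / 2"
    using tight[OF W, of "r / 2" 0] r by auto
  \<comment> \<open>If \<open>\<bar>W k\<bar> \<le> N\<close>, then \<open>\<bar>U k * W k\<bar> > c\<close> forces \<open>(U k)\<^sup>2 \<ge> a\<close>.\<close>
  define a where "a = (c / N)\<^sup>2"
  have a: "a > 0" using c N by (simp add: a_def)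
  have "eventually (\<lambda>k. expectation (\<lambda>\<omega>. (U k \<omega>)\<^sup>2) < r / 2 * a) sequentially"
    using lim r a by (intro order_tendstoD) auto
  then obtain k0 where k0: "\<And>k. k \<ge> k0 \<Longrightarrow> expectation (\<lambda>\<omega>. (U k \<omega>)\<^sup>2) < r / 2 * a"
    by (auto simp: eventually_sequentially)
  have "prob {\<omega> \<in> space M. \<bar>U k \<omega> * W k \<omega>\<bar> > c} < r" if k: "k \<ge> k0" for k
  proof -
    let ?A = "{\<omega> \<in> space M. (U k \<omega>)\<^sup>2 \<ge> a}" and ?B = "{\<omega> \<in> space M. \<bar>W k \<omega>\<bar> > real N}"
    have "{\<omega> \<in> space M. \<bar>U k \<omega> * W k \<omega>\<bar> > c} \<subseteq> ?A \<union> ?B"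
    proof (clarsimp)
      fix \<omega> assume *: "c < \<bar>U k \<omega> * W k \<omega>\<bar>" "\<not> real N < \<bar>W k \<omega>\<bar>"
      have "\<bar>U k \<omega> * W k \<omega>\<bar> \<le> \<bar>U k \<omega>\<bar> * N"
        using *(2) by (simp add: abs_mult mult_left_mono)
      then have "c / N \<le> \<bar>U k \<omega>\<bar>" using *(1) N by (simp add: field_simps)
      then show "a \<le> (U k \<omega>)\<^sup>2"
        unfolding a_def using c power_mono[of "c / N" "\<bar>U k \<omega>\<bar>" 2] by simp
    qed
    then have "prob {\<omega> \<in> space M. \<bar>U k \<omega> * W k \<omega>\<bar> > c} \<le> prob (?A \<union> ?B)"
      by (rule finite_measure_mono) measurable
    also have "\<dots> \<le> prob ?A + prob ?B"
      by (rule measure_Un_le) measurable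
    also have "prob ?A \<le> expectation (\<lambda>\<omega>. (U k \<omega>)\<^sup>2) / a"
      using U2[of k] a by (intro integral_Markov_inequality_measure[where A = "{}"]) auto
    also have "\<dots> < r / 2" using k0[OF k] a by (simp add: field_simps)
    also have "prob ?B = measure (distr M borel (W k)) {x. \<bar>x\<bar> > real N}"
      by (subst measure_distr) (auto intro!: arg_cong[where f = prob])
    also have "\<dots> = measure (distr M borel (W 0)) {x. \<bar>x\<bar> > real N}"
      by (subst law[of k]) (rule refl)
    also have "\<dots> = prob {\<omega> \<in> space M. \<bar>W 0 \<omega>\<bar> > real N}"
      by (subst measure_distr) (auto intro!: arg_cong[where f = prob])
    finally show ?thesis using N by simp
  qed
  then show "\<exists>k0. \<forall>k\<ge>k0. norm (prob {\<omega> \<in> space M. \<bar>U k \<omega> * W k \<omega>\<bar> > c} - 0) < r"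
    by auto
qed

text \<open>A form of Fatou's lemma for convergence in probability. The truncations \<open>min (X\<^sup>2) N\<close> have
  expectations that are bounded independently of \<open>N\<close>.\<close>

lemma (in prob_space) square_integrable_limit_in_probability:
  fixes X :: "'a \<Rightarrow> real" and S R :: "nat \<Rightarrow> 'a \<Rightarrow> real"
  assumes X [measurable]: "X \<in> borel_measurable M"
    and R [measurable]: "\<And>k. R k \<in> borel_measurable M"
    and S2: "\<And>k. integrable M (\<lambda>\<omega>. (S k \<omega>)\<^sup>2)"
    and C: "\<And>k. expectation (\<lambda>\<omega>. (S k \<omega>)\<^sup>2) \<le> C"
    and le: "\<And>k. AE \<omega> in M. X \<omega> = S k \<omega> + R k \<omega>"
    and lim: "(\<lambda>k. prob {\<omega> \<in> space M. \<bar>R k \<omega>\<bar> > 1}) \<longlonglongrightarrow> 0"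
  shows "integrable M (\<lambda>\<omega>. (X \<omega>)\<^sup>2)"
proof -
  define f where "f N \<omega> = min ((X \<omega>)\<^sup>2) (real N)" for N :: nat and \<omega>
  have f: "integrable M (f N)" for N
    by (rule integrable_const_bound[where B = "real N"]) (auto simp: f_def[abs_def])
  have bound: "expectation (f N) \<le> 2 * C + 2" for N
  proof -
    have "expectation (f N) \<le> 2 * C + 2 + real N * prob {\<omega> \<in> space M. \<bar>R k \<omega>\<bar> > 1}" for k
    proof -
      let ?A = "{\<omega> \<in> space M. \<bar>R k \<omega>\<bar> > 1}"
      let ?g = "\<lambda>\<omega>. 2 * (S k \<omega>)\<^sup>2 + 2 + real N * indicator ?A \<omega>"
      have "integrable M (indicat_real ?A)"
        by (rule integrable_const_bound[where B = 1]) auto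
      then have g: "has_bochner_integral M ?g (2 * expectation (\<lambda>\<omega>. (S k \<omega>)\<^sup>2) + 2 + real N * prob ?A)"
        by (intro has_bochner_integral_add has_bochner_integral_mult_right)
          (use S2 in \<open>auto simp: has_bochner_integral_iff prob_space\<close>)
      have "AE \<omega> in M. f N \<omega> \<le> ?g \<omega>"
        using le[of k] AE_space
      proof eventually_elim
        case (elim \<omega>)
        show ?case
        proof (cases "\<bar>R k \<omega>\<bar> > 1")
          case True
          have "f N \<omega> \<le> real N" by (simp add: f_def)
          also have "\<dots> \<le> ?g \<omega>" using True elim by simp
          finally show ?thesis .
        next
          case False
          have "(S k \<omega> + R k \<omega>)\<^sup>2 \<le> 2 * (S k \<omega>)\<^sup>2 + 2 * (R k \<omega>)\<^sup>2"
            using zero_le_power2[of "S k \<omega> - R k \<omega>"] by (simp add: power2_eq_square algebra_simps)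
          moreover have "(R k \<omega>)\<^sup>2 \<le> 1" using False abs_square_le_1[of "R k \<omega>"] by simp
          ultimately show ?thesis using elim False by (simp add: f_def)
        qed
      qed
      then have "expectation (f N) \<le> expectation ?g"
        using f g by (intro integral_mono_AE) (auto simp: has_bochner_integral_iff)
      also have "\<dots> \<le> 2 * C + 2 + real N * prob ?A"
        using has_bochner_integral_integral_eq[OF g] C[of k] by simp
      finally show ?thesis .
    qed
    moreover have "(\<lambda>k. 2 * C + 2 + real N * prob {\<omega> \<in> space M. \<bar>R k \<omega>\<bar> > 1}) \<longlonglongrightarrow> 2 * C + 2 + real N * 0"
      by (intro tendsto_intros lim)
    ultimately have "expectation (f N) \<le> 2 * C + 2 + real N * 0"
      by (intro LIMSEQ_le_const) auto
    then show ?thesis by simp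
  qed
  have mono: "f N \<omega> \<le> f N' \<omega>" if "N \<le> N'" for N N' \<omega>
    using that by (auto simp: f_def)
  have "incseq (\<lambda>N. expectation (f N))"
    using f mono by (intro incseq_SucI integral_mono) auto
  then obtain L where L: "(\<lambda>N. expectation (f N)) \<longlonglongrightarrow> L"
    using incseq_convergent[of "\<lambda>N. expectation (f N)" "2 * C + 2"] bound by blast
  show ?thesis
  proof (rule integrable_monotone_convergence[OF f _ _ L])
    show "AE \<omega> in M. mono (\<lambda>N. f N \<omega>)" using mono by (auto simp: mono_def)
    have "(\<lambda>N. f N \<omega>) \<longlonglongrightarrow> (X \<omega>)\<^sup>2" for \<omega>
    proof (rule tendsto_eventually)
      obtain N0 :: nat where "(X \<omega>)\<^sup>2 \<le> real N0" using real_arch_simple by blast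
      then show "eventually (\<lambda>N. f N \<omega> = (X \<omega>)\<^sup>2) sequentially"
        unfolding eventually_sequentially f_def by (intro exI[of _ N0]) auto
    qed
    then show "AE \<omega> in M. (\<lambda>N. f N \<omega>) \<longlonglongrightarrow> (X \<omega>)\<^sup>2" by simp
  qed measurable
qed

section \<open>Innovations and independence\<close>

text \<open>The coefficients and innovations of the model.\<close>

locale pgarch = prob_space M for M :: "'a measure" +
  fixes s p q :: nat and \<alpha>0 :: "nat \<Rightarrow> real" and \<alpha> \<beta> :: "nat \<Rightarrow> nat \<Rightarrow> real"
    and \<epsilon> :: "int \<Rightarrow> 'a \<Rightarrow> real"
  assumes s: "s \<ge> 1" and p: "p \<ge> 1" and q: "q \<ge> 1"
    and \<alpha>0: "\<And>v. v \<in> {1..s} \<Longrightarrow> \<alpha>0 v > 0"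
    and \<alpha>: "\<And>i v. i \<in> {1..p} \<Longrightarrow> v \<in> {1..s} \<Longrightarrow> \<alpha> i v \<ge> 0"
    and \<beta>: "\<And>j v. j \<in> {1..q} \<Longrightarrow> v \<in> {1..s} \<Longrightarrow> \<beta> j v \<ge> 0"
    and indep_eps: "indep_vars (\<lambda>_. borel) \<epsilon> UNIV"
    and distr_eps: "\<And>t u. distr M borel (\<epsilon> t) = distr M borel (\<epsilon> u)"
    and var_eps: "\<And>t. has_bochner_integral M (\<lambda>\<omega>. \<epsilon> t \<omega> ^ 2) 1"
    and kappa2: "\<And>t. kappa M (\<epsilon> t) 2 < \<infinity>"
begin

lemma eps_measurable [measurable]: "\<epsilon> n \<in> borel_measurable M"
  using indep_eps by (auto simp: indep_vars_def)

text \<open>The \<open>\<sigma>\<close>-algebra generated by the innovations with times in \<open>J\<close>, represented by a measure space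
  whose measure is irrelevant.\<close>

definition eps_algebra :: "int set \<Rightarrow> 'a measure" where
  "eps_algebra J = sigma (space M) (\<Union>m\<in>J. {\<epsilon> m -` A \<inter> space M |A. A \<in> sets borel})"

lemma space_eps_algebra [simp]: "space (eps_algebra J) = space M"
  unfolding eps_algebra_def by (rule space_measure_of) auto

lemma sets_eps_algebra: "sets (eps_algebra J) = sigma_sets (space M) (\<Union>m\<in>J. {\<epsilon> m -` A \<inter> space M |A. A \<in> sets borel})"
  unfolding eps_algebra_def by (rule sets_measure_of) auto

lemma eps_measurable_algebra: "m \<in> J \<Longrightarrow> \<epsilon> m \<in> borel_measurable (eps_algebra J)"
  by (rule measurableI) (auto simp: sets_eps_algebra)

lemma eps_algebra_mono:
  assumes "J \<subseteq> K" "f \<in> borel_measurable (eps_algebra J)"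
  shows "f \<in> borel_measurable (eps_algebra K)"
proof -
  have "sets (eps_algebra J) \<subseteq> sets (eps_algebra K)"
    unfolding sets_eps_algebra using assms(1) by (intro sigma_sets_mono') blast
  then show ?thesis
    using assms(2) by (auto simp: measurable_def)
qed

lemma eps_algebra_measurable:
  assumes "f \<in> borel_measurable (eps_algebra J)"
  shows "f \<in> borel_measurable M"
proof -
  have "sets (eps_algebra J) \<subseteq> sets M"
    unfolding sets_eps_algebra by (intro sets.sigma_sets_subset) (auto intro: measurable_sets)
  then show ?thesis
    using assms by (auto simp: measurable_def)
qed

lemma indep_eps_algebra:
  assumes IJ: "I \<inter> J = {}" and f: "f \<in> borel_measurable (eps_algebra I)" and g: "g \<in> borel_measurable (eps_algebra J)"
  shows "indep_var borel f borel (g :: _ \<Rightarrow> real)"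
proof -
  let ?E = "\<lambda>m. {\<epsilon> m -` A \<inter> space M |A. A \<in> sets borel}"
  let ?I = "case_bool I J"
  have "indep_sets ?E (\<Union>b\<in>UNIV. ?I b)"
    by (rule indep_sets_mono_index[of _ UNIV])
      (use indep_eps in \<open>simp_all add: indep_vars_def2\<close>)
  then have "indep_sets (\<lambda>b. sigma_sets (space M) (\<Union>m\<in>?I b. ?E m)) UNIV"
  proof (rule indep_sets_collect_sigma)
    fix m
    show "Int_stable (?E m)"
      unfolding Int_stable_def
    proof safe
      fix A B :: "real set" assume "A \<in> sets borel" "B \<in> sets borel"
      then show "\<exists>C. \<epsilon> m -` A \<inter> space M \<inter> (\<epsilon> m -` B \<inter> space M) = \<epsilon> m -` C \<inter> space M \<and> C \<in> sets borel"
        by (intro exI[of _ "A \<inter> B"]) auto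
    qed
    show "disjoint_family_on ?I UNIV"
      using IJ by (auto simp: disjoint_family_on_def split: bool.split)
  qed
  then have "indep_set (sets (eps_algebra I)) (sets (eps_algebra J))"
    unfolding indep_set_def
    by (rule indep_sets_mono_sets) (auto simp: sets_eps_algebra split: bool.split)
  moreover have "sigma_sets (space M) {h -` A \<inter> space M |A. A \<in> sets borel} \<subseteq> sets (eps_algebra K)"
    if "h \<in> borel_measurable (eps_algebra K)" for h :: "'a \<Rightarrow> real" and K
  proof -
    have "{h -` A \<inter> space M |A. A \<in> sets borel} \<subseteq> sets (eps_algebra K)"
      using measurable_sets[OF that] by auto
    then show ?thesis using sets.sigma_sets_subset[of _ "eps_algebra K"] by simp
  qed
  ultimately have "indep_set (sigma_sets (space M) {f -` A \<inter> space M |A. A \<in> sets borel})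
       (sigma_sets (space M) {g -` A \<inter> space M |A. A \<in> sets borel})"
    using f g unfolding indep_set_def
    by (elim indep_sets_mono_sets) (auto split: bool.split)
  then show ?thesis
    unfolding indep_var_eq using f g eps_algebra_measurable by blast
qed

lemma expectation_mult_independent:
  assumes f: "f \<in> borel_measurable (eps_algebra {n})" "has_bochner_integral M f a"
    and g: "g \<in> borel_measurable (eps_algebra {..<n})" "integrable M g"
  shows "has_bochner_integral M (\<lambda>\<omega>. f \<omega> * g \<omega> :: real) (a * expectation g)"
proof -
  have ind: "indep_var borel f borel g"
    by (rule indep_eps_algebra[OF _ f(1) g(1)]) auto
  show ?thesis
    using indep_var_integrable[OF ind] indep_var_lebesgue_integral[OF ind] f g
    by (simp add: has_bochner_integral_iff)
qed

section \<open>The recursion over one season\<close>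

abbreviation "d \<equiv> p + q"

text \<open>The season \<open>v \<in> {1..s}\<close> of the time \<open>n = s t + v\<close>.\<close>

definition season :: "int \<Rightarrow> nat" where
  "season n = nat ((n - 1) mod int s) + 1"

lemma season_in: "season n \<in> {1..s}"
proof -
  have "0 \<le> (n - 1) mod int s" "(n - 1) mod int s < int s" using s by simp_all
  then show ?thesis unfolding season_def using s by (simp add: nat_less_iff Suc_le_eq)
qed

lemma season_eq:
  assumes "v \<in> {1..s}"
  shows "season (int s * t + int v) = v"
proof -
  have "(int s * t + int v - 1) mod int s = (int v - 1) mod int s"
  proof -
    have "int s * t + int v - 1 = (int v - 1) + int s * t" by simp
    then show ?thesis by (simp only: mod_mult_self2)
  qed
  also have "\<dots> = int v - 1" using assms by (intro mod_pos_pos_trivial) auto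
  finally show ?thesis unfolding season_def using assms by auto
qed

text \<open>The row of coefficients of the volatility equation, with columns counted from 0: first the
  \<open>\<alpha>\<close>'s, then the \<open>\<beta>\<close>'s.\<close>

definition lin :: "nat \<Rightarrow> nat \<Rightarrow> real" where
  "lin v j = (if j < p then \<alpha> (j + 1) v else \<beta> (j - p + 1) v)"

text \<open>The entries of the matrix \<open>\<phi>\<^sub>v\<close> are affine in the squared innovation \<open>x\<close>: entry \<open>(i, j)\<close> is
  \<open>phi1 v i j * x + phi0 v i j\<close>.\<close>

definition phi1 :: "nat \<Rightarrow> nat \<Rightarrow> nat \<Rightarrow> real" where
  "phi1 v i j = (if i = 0 then lin v j else 0)"

definition phi0 :: "nat \<Rightarrow> nat \<Rightarrow> nat \<Rightarrow> real" where
  "phi0 v i j = (if i = 0 then 0 else if i = p then lin v j else if i = j + 1 then 1 else 0)"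

text \<open>The random matrix \<open>\<phi>\<^sub>n\<close> and the random vector \<open>b\<^sub>n\<close> of the recursion at time \<open>n\<close>, entrywise. Vectors
  of length \<open>d\<close> are represented by functions on \<open>nat\<close> of which only the values below \<open>d\<close> matter.\<close>

definition phi :: "int \<Rightarrow> nat \<Rightarrow> nat \<Rightarrow> 'a \<Rightarrow> real" where
  "phi n i j \<omega> = phi1 (season n) i j * (\<epsilon> n \<omega>)\<^sup>2 + phi0 (season n) i j"

definition offset :: "int \<Rightarrow> nat \<Rightarrow> 'a \<Rightarrow> real" where
  "offset n i \<omega> = (if i = 0 then \<alpha>0 (season n) * (\<epsilon> n \<omega>)\<^sup>2 else if i = p then \<alpha>0 (season n) else 0)"

lemma pgarch_phi_carrier: "pgarch_phi p q \<alpha> \<beta> v e \<in> carrier_mat d d"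
  unfolding pgarch_phi_def by auto

lemma pgarch_phi_entry:
  assumes "i < d" "j < d"
  shows "pgarch_phi p q \<alpha> \<beta> v e $$ (i, j) = phi1 v i j * e $ (v - 1) + phi0 v i j"
proof (cases "i < p")
  case True
  then show ?thesis
    using assms unfolding pgarch_phi_def phi1_def phi0_def lin_def
    by (cases "j < p") simp_all
next
  case False
  then obtain i' where i': "i = p + i'" using le_Suc_ex[of p i] by auto
  show ?thesis
    using assms p unfolding pgarch_phi_def phi1_def phi0_def lin_def i'
    by (cases "j < p") (simp_all, linarith)
qed

lemma lin_nonneg: "v \<in> {1..s} \<Longrightarrow> j < d \<Longrightarrow> lin v j \<ge> 0"
  unfolding lin_def using \<alpha> \<beta> by auto

lemma phi01_nonneg:
  "v \<in> {1..s} \<Longrightarrow> j < d \<Longrightarrow> phi1 v i j \<ge> 0" "v \<in> {1..s} \<Longrightarrow> j < d \<Longrightarrow> phi0 v i j \<ge> 0"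
  unfolding phi1_def phi0_def using lin_nonneg by auto

lemma phi_nonneg: "j < d \<Longrightarrow> phi n i j \<omega> \<ge> 0"
  unfolding phi_def using phi01_nonneg[OF season_in] by simp

lemma offset_nonneg: "offset n i \<omega> \<ge> 0"
  unfolding offset_def using \<alpha>0[OF season_in, of n] by simp

lemma phi_measurable: "n \<in> J \<Longrightarrow> phi n i j \<in> borel_measurable (eps_algebra J)"
  and offset_measurable: "n \<in> J \<Longrightarrow> offset n i \<in> borel_measurable (eps_algebra J)"
proof -
  assume "n \<in> J"
  then have [measurable]: "\<epsilon> n \<in> borel_measurable (eps_algebra J)" by (rule eps_measurable_algebra)
  show "phi n i j \<in> borel_measurable (eps_algebra J)" unfolding phi_def by measurable
  show "offset n i \<in> borel_measurable (eps_algebra J)" unfolding offset_def by measurable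
qed

lemma eta_entry:
  assumes "v \<in> {1..s}"
  shows "pgarch_eta s \<epsilon> t \<omega> $ (v - 1) = (\<epsilon> (int s * t + int v) \<omega>)\<^sup>2"
proof -
  have "v - 1 < s" "int (v - 1 + 1) = int v" using assms by auto
  then show ?thesis by (simp add: pgarch_eta_def del: One_nat_def)
qed

lemma phi_eq:
  assumes "v \<in> {1..s}" "i < d" "j < d"
  shows "pgarch_phi p q \<alpha> \<beta> v (pgarch_eta s \<epsilon> t \<omega>) $$ (i, j) = phi (int s * t + int v) i j \<omega>"
  using assms by (simp only: pgarch_phi_entry phi_def season_eq eta_entry)

lemma offset_eq:
  assumes "v \<in> {1..s}" "i < d"
  shows "pgarch_b p q \<alpha>0 v (pgarch_eta s \<epsilon> t \<omega>) $ i = offset (int s * t + int v) i \<omega>"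
  using assms eta_entry[OF assms(1)] by (simp add: pgarch_b_def offset_def season_eq)

lemma pgarch_phi_prod_self: "pgarch_phi_prod p q \<alpha> \<beta> v v e = 1\<^sub>m d"
  unfolding pgarch_phi_prod_def by simp

lemma pgarch_phi_prod_carrier: "pgarch_phi_prod p q \<alpha> \<beta> v k e \<in> carrier_mat d d"
  unfolding pgarch_phi_prod_def by (rule mat_prod_carrier) (use pgarch_phi_carrier in auto)

lemma pgarch_phi_prod_Suc:
  assumes "k \<le> v"
  shows "pgarch_phi_prod p q \<alpha> \<beta> (Suc v) k e = pgarch_phi p q \<alpha> \<beta> (Suc v) e * pgarch_phi_prod p q \<alpha> \<beta> v k e"
proof -
  have "[0..<Suc v - k] = 0 # map Suc [0..<v - k]"
    using assms by (simp only: Suc_diff_le upt_conv_Cons[of 0 "Suc (v - k)"] map_Suc_upt)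
  then show ?thesis unfolding pgarch_phi_prod_def by (simp add: comp_def)
qed

text \<open>The state after season \<open>v\<close> of a period with squared innovations \<open>e\<close> that starts from the state \<open>u\<close>,
  in the closed form in which it appears in the block recursion.\<close>

definition season_state :: "real vec \<Rightarrow> (nat \<Rightarrow> real) \<Rightarrow> nat \<Rightarrow> nat \<Rightarrow> real" where
  "season_state e u v i = (\<Sum>j<d. pgarch_phi_prod p q \<alpha> \<beta> v 0 e $$ (i, j) * u j)
     + (\<Sum>k = 1..v. (pgarch_phi_prod p q \<alpha> \<beta> v k e *\<^sub>v pgarch_b p q \<alpha>0 k e) $ i)"

lemma season_state_0: "i < d \<Longrightarrow> season_state e u 0 i = u i"
proof -
  assume i: "i < d"
  have "(\<Sum>j<d. 1\<^sub>m d $$ (i, j) * u j) = (\<Sum>j<d. if i = j then u j else 0)"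
    using i by (intro sum.cong) auto
  then show ?thesis using i by (simp add: season_state_def pgarch_phi_prod_self)
qed

lemma season_state_Suc:
  assumes i: "i < d"
  shows "season_state e u (Suc v) i
    = (\<Sum>j<d. pgarch_phi p q \<alpha> \<beta> (Suc v) e $$ (i, j) * season_state e u v j) + pgarch_b p q \<alpha>0 (Suc v) e $ i"
proof -
  let ?P = "pgarch_phi_prod p q \<alpha> \<beta>" and ?F = "pgarch_phi p q \<alpha> \<beta> (Suc v) e" and ?b = "\<lambda>k. pgarch_b p q \<alpha>0 k e"
  have F: "dim_row ?F = d" "dim_col ?F = d" using pgarch_phi_carrier by auto
  have P: "dim_row (?P v k e) = d" "dim_col (?P v k e) = d" for k using pgarch_phi_prod_carrier by auto
  have b: "?b k \<in> carrier_vec d" for k unfolding pgarch_b_def by simp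
  have "(\<Sum>j<d. ?P (Suc v) 0 e $$ (i, j) * u j) = (\<Sum>j<d. (\<Sum>m<d. ?F $$ (i, m) * ?P v 0 e $$ (m, j)) * u j)"
    using i F P by (intro sum.cong) (auto simp: pgarch_phi_prod_Suc scalar_prod_def lessThan_atLeast0)
  also have "\<dots> = (\<Sum>m<d. ?F $$ (i, m) * (\<Sum>j<d. ?P v 0 e $$ (m, j) * u j))"
    unfolding sum_distrib_left sum_distrib_right mult.assoc by (rule sum.swap)
  finally have 1: "(\<Sum>j<d. ?P (Suc v) 0 e $$ (i, j) * u j) = \<dots>" .
  have "(\<Sum>k = 1..v. (?P (Suc v) k e *\<^sub>v ?b k) $ i) = (\<Sum>k = 1..v. \<Sum>m<d. ?F $$ (i, m) * (?P v k e *\<^sub>v ?b k) $ m)"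
  proof (rule sum.cong[OF refl])
    fix k assume "k \<in> {1..v}"
    then have "?P (Suc v) k e *\<^sub>v ?b k = ?F *\<^sub>v (?P v k e *\<^sub>v ?b k)"
      using assoc_mult_mat_vec[OF pgarch_phi_carrier pgarch_phi_prod_carrier b]
      by (simp add: pgarch_phi_prod_Suc)
    then show "(?P (Suc v) k e *\<^sub>v ?b k) $ i = (\<Sum>m<d. ?F $$ (i, m) * (?P v k e *\<^sub>v ?b k) $ m)"
      using i F P[of k] by (simp add: scalar_prod_def lessThan_atLeast0)
  qed
  also have "\<dots> = (\<Sum>m<d. ?F $$ (i, m) * (\<Sum>k = 1..v. (?P v k e *\<^sub>v ?b k) $ m))"
    unfolding sum_distrib_left by (rule sum.swap)
  finally have 2: "(\<Sum>k = 1..v. (?P (Suc v) k e *\<^sub>v ?b k) $ i) = \<dots>" .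
  have 3: "(?P (Suc v) (Suc v) e *\<^sub>v ?b (Suc v)) $ i = ?b (Suc v) $ i"
    using b by (simp add: pgarch_phi_prod_self)
  show ?thesis
    unfolding season_state_def using 1 2 3
    by (simp add: distrib_left sum.distrib)
qed

text \<open>Only the last block column of the matrix \<open>A\<close> is nonzero, so that only the last block of \<open>x\<close> matters.\<close>

lemma pgarch_recursion_entry:
  assumes w: "w < s" and i: "i < d" and x: "dim_vec x = d * s"
  shows "(pgarch_A s p q \<alpha> \<beta> e *\<^sub>v x + pgarch_B s p q \<alpha>0 \<alpha> \<beta> e) $ (w * d + i)
    = season_state e (\<lambda>j. x $ ((s - 1) * d + j)) (Suc w) i"
proof -
  let ?P = "pgarch_phi_prod p q \<alpha> \<beta> (Suc w) 0 e"
  have "w * d + i < Suc w * d" using i by simp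
  also have "\<dots> \<le> s * d" using w by (intro mult_le_mono1) auto
  finally have lt: "w * d + i < d * s" by (simp only: mult.commute)
  have "d \<noteq> 0" using p by simp
  then have dm: "(w * d + i) div d = w" "(w * d + i) mod d = i"
    using i by (simp_all only: div_mult_self3 mod_mult_self3 div_less mod_less add_0_right not_False_eq_True)
  have "(pgarch_A s p q \<alpha> \<beta> e *\<^sub>v x) $ (w * d + i) = (\<Sum>J<d * s. pgarch_A s p q \<alpha> \<beta> e $$ (w * d + i, J) * x $ J)"
    using lt x by (simp add: pgarch_A_def Let_def scalar_prod_def lessThan_atLeast0)
  also have "\<dots> = (\<Sum>J<s * d. (if J div d + 1 = s then ?P $$ (i, J mod d) else 0) * x $ ((J div d) * d + J mod d))"
    using lt dm by (intro sum.cong) (auto simp: pgarch_A_def Let_def mult.commute)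
  also have "\<dots> = (\<Sum>m<s. \<Sum>j<d. (if m + 1 = s then ?P $$ (i, j) else 0) * x $ (m * d + j))"
    by (rule sum_div_mod)
  also have "\<dots> = (\<Sum>m<s. if m = s - 1 then (\<Sum>j<d. ?P $$ (i, j) * x $ (m * d + j)) else 0)"
    using s by (intro sum.cong) auto
  also have "\<dots> = (\<Sum>j<d. ?P $$ (i, j) * x $ ((s - 1) * d + j))"
    using s by simp
  finally have "(pgarch_A s p q \<alpha> \<beta> e *\<^sub>v x) $ (w * d + i) = \<dots>" .
  moreover have "pgarch_B s p q \<alpha>0 \<alpha> \<beta> e $ (w * d + i)
      = (\<Sum>k = 1..Suc w. (pgarch_phi_prod p q \<alpha> \<beta> (Suc w) k e *\<^sub>v pgarch_b p q \<alpha>0 k e) $ i)"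
    using lt dm by (simp add: pgarch_B_def Let_def)
  moreover have "w * d + i < dim_vec (pgarch_B s p q \<alpha>0 \<alpha> \<beta> e)" using lt by (simp add: pgarch_B_def Let_def)
  ultimately show ?thesis by (simp only: season_state_def index_add_vec)
qed

section \<open>Second moments under one season and under one period\<close>

text \<open>The fourth moment of the innovations, called \<open>\<kappa>\<^sub>2\<close> in the model.\<close>

definition \<kappa> :: real where "\<kappa> = expectation (\<lambda>\<omega>. (\<epsilon> 0 \<omega>) ^ 4)"

lemma eps4: "has_bochner_integral M (\<lambda>\<omega>. (\<epsilon> n \<omega>) ^ 4) \<kappa>"
proof -
  have *: "integrable M (\<lambda>\<omega>. (\<epsilon> m \<omega>) ^ 4)" for m
  proof (rule integrableI_nonneg)
    show "(\<integral>\<^sup>+ \<omega>. ennreal (\<epsilon> m \<omega> ^ 4) \<partial>M) < \<infinity>"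
      using kappa2[of m] unfolding kappa_def by simp
  qed auto
  have "expectation (\<lambda>\<omega>. (\<epsilon> n \<omega>) ^ 4) = (\<integral>x. x ^ 4 \<partial>distr M borel (\<epsilon> n))"
    by (subst integral_distr) auto
  also have "\<dots> = (\<integral>x. x ^ 4 \<partial>distr M borel (\<epsilon> 0))"
    using distr_eps[of n 0] by simp
  also have "\<dots> = \<kappa>"
    unfolding \<kappa>_def by (subst integral_distr) auto
  finally show ?thesis using *[of n] by (simp add: has_bochner_integral_iff)
qed

lemma kappa_ge_1: "\<kappa> \<ge> 1"
proof -
  have "has_bochner_integral M (\<lambda>\<omega>. (\<epsilon> 0 \<omega>) ^ 4 - 2 * (\<epsilon> 0 \<omega>)\<^sup>2 + 1) (\<kappa> - 2 * 1 + 1)"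
    by (intro has_bochner_integral_add has_bochner_integral_diff has_bochner_integral_mult_right eps4 var_eps)
      (simp add: has_bochner_integral_iff prob_space)
  moreover have "(\<epsilon> 0 \<omega>) ^ 4 - 2 * (\<epsilon> 0 \<omega>)\<^sup>2 + 1 = ((\<epsilon> 0 \<omega>)\<^sup>2 - 1)\<^sup>2" for \<omega>
    by (simp add: power2_eq_square power4_eq_xxxx algebra_simps)
  ultimately have "\<kappa> - 2 * 1 + 1 = expectation (\<lambda>\<omega>. ((\<epsilon> 0 \<omega>)\<^sup>2 - 1)\<^sup>2)"
    by (simp add: has_bochner_integral_iff)
  also have "\<dots> \<ge> 0" by simp
  finally show ?thesis by simp
qed

text \<open>The expectation of the product of the entries \<open>(i, j)\<close> and \<open>(k, l)\<close> of \<open>\<phi>\<^sub>v\<close>; recall that the squared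
  innovations have mean 1 and second moment \<open>\<kappa>\<close>.\<close>

definition K :: "nat \<Rightarrow> nat \<Rightarrow> nat \<Rightarrow> nat \<Rightarrow> nat \<Rightarrow> real" where
  "K v i j k l = phi1 v i j * phi1 v k l * \<kappa> + (phi1 v i j * phi0 v k l + phi0 v i j * phi1 v k l)
     + phi0 v i j * phi0 v k l"

lemma K_nonneg: "v \<in> {1..s} \<Longrightarrow> j < d \<Longrightarrow> l < d \<Longrightarrow> K v i j k l \<ge> 0"
  unfolding K_def using phi01_nonneg kappa_ge_1 by (auto intro!: add_nonneg_nonneg mult_nonneg_nonneg)

lemma affine_products:
  "has_bochner_integral M (\<lambda>\<omega>. (a * (\<epsilon> n \<omega>)\<^sup>2 + b) * (a' * (\<epsilon> n \<omega>)\<^sup>2 + b'))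
     (a * a' * \<kappa> + (a * b' + b * a') + b * b')"
proof -
  have "has_bochner_integral M (\<lambda>\<omega>. a * a' * (\<epsilon> n \<omega>) ^ 4 + (a * b' + b * a') * (\<epsilon> n \<omega>)\<^sup>2 + b * b')
     (a * a' * \<kappa> + (a * b' + b * a') * 1 + b * b')"
    by (intro has_bochner_integral_add has_bochner_integral_mult_right eps4 var_eps)
      (simp add: has_bochner_integral_iff prob_space)
  moreover have "a * a' * (\<epsilon> n \<omega>) ^ 4 + (a * b' + b * a') * (\<epsilon> n \<omega>)\<^sup>2 + b * b'
     = (a * (\<epsilon> n \<omega>)\<^sup>2 + b) * (a' * (\<epsilon> n \<omega>)\<^sup>2 + b')" for \<omega>
    by (simp add: power2_eq_square power4_eq_xxxx algebra_simps)
  ultimately show ?thesis by simp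
qed

lemma phi_products: "has_bochner_integral M (\<lambda>\<omega>. phi n i j \<omega> * phi n k l \<omega>) (K (season n) i j k l)"
  unfolding phi_def K_def by (rule affine_products)

text \<open>The expected Kronecker square of \<open>\<phi>\<^sub>v\<close>.\<close>

definition Kmat :: "nat \<Rightarrow> real mat" where
  "Kmat v = mat (d * d) (d * d) (\<lambda>(I, J). K v (I div d) (J div d) (I mod d) (J mod d))"

lemma Kmat_carrier [simp]: "Kmat v \<in> carrier_mat (d * d) (d * d)"
  unfolding Kmat_def by simp

lemma div_mod_less:
  assumes "I < d * d" shows "I div d < d" "I mod d < d"
proof -
  have "d > 0" using p by simp
  then show "I div d < d" "I mod d < d" using assms by (auto simp: less_mult_imp_div_less)
qed

text \<open>The product of the expected Kronecker squares over one period, latest season first.\<close>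

definition period_mat :: "real mat" where
  "period_mat = mat_prod (d * d) (map (\<lambda>v. Kmat (s - v)) [0..<s])"

lemma moment_mat_eq: "pgarch_moment_mat M s p q \<alpha> \<beta> \<epsilon> 2 t0 = period_mat"
proof -
  have "expect_mat M (d * d) (\<lambda>\<omega>. kron_mat_power (pgarch_phi p q \<alpha> \<beta> v (pgarch_eta s \<epsilon> t0 \<omega>)) 2) = Kmat v"
    if v: "v \<in> {1..s}" for v
  proof (rule eq_matI)
    fix I J assume "I < dim_row (Kmat v)" "J < dim_col (Kmat v)"
    then have IJ: "I < d * d" "J < d * d" by (auto simp: Kmat_def)
    note less = div_mod_less[OF IJ(1)] div_mod_less[OF IJ(2)]
    let ?n = "int s * t0 + int v"
    have "expect_mat M (d * d) (\<lambda>\<omega>. kron_mat_power (pgarch_phi p q \<alpha> \<beta> v (pgarch_eta s \<epsilon> t0 \<omega>)) 2) $$ (I, J)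
       = expectation (\<lambda>\<omega>. phi ?n (I div d) (J div d) \<omega> * phi ?n (I mod d) (J mod d) \<omega>)"
      using IJ less by (simp add: expect_mat_def kron_mat_power_2[OF pgarch_phi_carrier] phi_eq[OF v])
    also have "\<dots> = K (season ?n) (I div d) (J div d) (I mod d) (J mod d)"
      using phi_products by (rule has_bochner_integral_integral_eq)
    also have "\<dots> = Kmat v $$ (I, J)" using IJ v by (simp add: season_eq Kmat_def)
    finally show "expect_mat M (d * d) (\<lambda>\<omega>. kron_mat_power (pgarch_phi p q \<alpha> \<beta> v (pgarch_eta s \<epsilon> t0 \<omega>)) 2) $$ (I, J)
       = Kmat v $$ (I, J)" .
  qed (auto simp: expect_mat_def Kmat_def)
  then show ?thesis
    unfolding pgarch_moment_mat_def period_mat_def Let_def power2_eq_square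
    by (intro arg_cong[where f = "mat_prod (d * d)"] map_cong) auto
qed

text \<open>The random vector \<open>\<phi>\<^sub>n z\<close>.\<close>

definition step :: "int \<Rightarrow> (nat \<Rightarrow> 'a \<Rightarrow> real) \<Rightarrow> nat \<Rightarrow> 'a \<Rightarrow> real" where
  "step n z i \<omega> = (\<Sum>j<d. phi n i j \<omega> * z j \<omega>)"

text \<open>The random vector \<open>\<phi>\<^sub>n \<phi>\<^bsub>n-1\<^esub> \<cdots> \<phi>\<^bsub>n-k+1\<^esub> z\<close>.\<close>

primrec T :: "nat \<Rightarrow> int \<Rightarrow> (nat \<Rightarrow> 'a \<Rightarrow> real) \<Rightarrow> nat \<Rightarrow> 'a \<Rightarrow> real" where
  "T 0 n z = z"
| "T (Suc k) n z = step n (T k (n - 1) z)"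

text \<open>The value at time \<open>n\<close> of the recursion started from 0 at time \<open>n - k\<close>.\<close>

primrec S :: "nat \<Rightarrow> int \<Rightarrow> nat \<Rightarrow> 'a \<Rightarrow> real" where
  "S 0 n = (\<lambda>i \<omega>. 0)"
| "S (Suc k) n = (\<lambda>i \<omega>. step n (S k (n - 1)) i \<omega> + offset n i \<omega>)"

text \<open>A square-integrable random vector that is a function of the innovations up to time \<open>n\<close>.\<close>

definition adapted :: "int \<Rightarrow> (nat \<Rightarrow> 'a \<Rightarrow> real) \<Rightarrow> bool" where
  "adapted n z \<longleftrightarrow> (\<forall>i<d. z i \<in> borel_measurable (eps_algebra {..n}) \<and> integrable M (\<lambda>\<omega>. (z i \<omega>)\<^sup>2))"

text \<open>The expected Kronecker square of a random vector, with index \<open>i * d + j\<close> for the pair \<open>(i, j)\<close>.\<close>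

definition mom :: "(nat \<Rightarrow> 'a \<Rightarrow> real) \<Rightarrow> real vec" where
  "mom z = vec (d * d) (\<lambda>I. expectation (\<lambda>\<omega>. z (I div d) \<omega> * z (I mod d) \<omega>))"

text \<open>The expected squared Euclidean norm.\<close>

definition V :: "(nat \<Rightarrow> 'a \<Rightarrow> real) \<Rightarrow> real" where
  "V z = (\<Sum>i<d. expectation (\<lambda>\<omega>. (z i \<omega>)\<^sup>2))"

lemma adapted_integrable:
  assumes "adapted n z" "i < d" "j < d"
  shows "integrable M (\<lambda>\<omega>. z i \<omega> * z j \<omega>)"
  using assms unfolding adapted_def
  by (intro integrable_mult_of_squares eps_algebra_measurable) auto

lemma adapted_mono: "adapted m z \<Longrightarrow> m \<le> n \<Longrightarrow> adapted n z"
  unfolding adapted_def using eps_algebra_mono[of "{..m}" "{..n}"] by auto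

lemma step_products:
  assumes z: "adapted (n - 1) z"
  shows "has_bochner_integral M (\<lambda>\<omega>. step n z i \<omega> * step n z k \<omega>)
    (\<Sum>j<d. \<Sum>l<d. K (season n) i j k l * expectation (\<lambda>\<omega>. z j \<omega> * z l \<omega>))"
proof -
  have "has_bochner_integral M (\<lambda>\<omega>. (phi n i j \<omega> * phi n k l \<omega>) * (z j \<omega> * z l \<omega>))
     (K (season n) i j k l * expectation (\<lambda>\<omega>. z j \<omega> * z l \<omega>))" if "j < d" "l < d" for j l
  proof (rule expectation_mult_independent)
    show "(\<lambda>\<omega>. phi n i j \<omega> * phi n k l \<omega>) \<in> borel_measurable (eps_algebra {n})"
      using phi_measurable[of n "{n}"] by (intro borel_measurable_times) auto
    have "{..n - 1} = {..<n}" by auto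
    then show "(\<lambda>\<omega>. z j \<omega> * z l \<omega>) \<in> borel_measurable (eps_algebra {..<n})"
      using z that unfolding adapted_def by (intro borel_measurable_times) auto
  qed (use phi_products adapted_integrable[OF z] that in auto)
  then have "has_bochner_integral M (\<lambda>\<omega>. \<Sum>j<d. \<Sum>l<d. (phi n i j \<omega> * phi n k l \<omega>) * (z j \<omega> * z l \<omega>))
     (\<Sum>j<d. \<Sum>l<d. K (season n) i j k l * expectation (\<lambda>\<omega>. z j \<omega> * z l \<omega>))"
    by (intro has_bochner_integral_sum) auto
  also have "(\<lambda>\<omega>. \<Sum>j<d. \<Sum>l<d. (phi n i j \<omega> * phi n k l \<omega>) * (z j \<omega> * z l \<omega>))
     = (\<lambda>\<omega>. step n z i \<omega> * step n z k \<omega>)"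
    unfolding step_def sum_product by (intro ext sum.cong refl) (simp add: mult_ac)
  finally show ?thesis .
qed

lemma adapted_step:
  assumes z: "adapted (n - 1) z"
  shows "adapted n (step n z)"
  unfolding adapted_def
proof (intro allI impI conjI)
  fix i assume "i < d"
  have "z j \<in> borel_measurable (eps_algebra {..n})" if "j < d" for j
    using adapted_mono[OF z, of n] that unfolding adapted_def by auto
  then show "step n z i \<in> borel_measurable (eps_algebra {..n})"
    unfolding step_def[abs_def] using phi_measurable[of n "{..n}"]
    by (intro borel_measurable_sum borel_measurable_times) auto
  show "integrable M (\<lambda>\<omega>. (step n z i \<omega>)\<^sup>2)"
    using step_products[OF z, of i i] by (simp add: has_bochner_integral_iff power2_eq_square)
qed

text \<open>The vector \<open>z\<close> depends on innovations before time \<open>n\<close> and is thus independent of \<open>\<phi>\<^sub>n\<close>, which makes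
  second moments evolve linearly.\<close>

lemma mom_step:
  assumes z: "adapted (n - 1) z"
  shows "mom (step n z) = Kmat (season n) *\<^sub>v mom z"
proof (rule eq_vecI)
  fix I assume "I < dim_vec (Kmat (season n) *\<^sub>v mom z)"
  then have I: "I < d * d" by (simp add: Kmat_def)
  have "mom (step n z) $ I = (\<Sum>j<d. \<Sum>l<d. K (season n) (I div d) j (I mod d) l * expectation (\<lambda>\<omega>. z j \<omega> * z l \<omega>))"
    using I has_bochner_integral_integral_eq[OF step_products[OF z]] by (simp add: mom_def)
  also have "\<dots> = (\<Sum>J<d * d. K (season n) (I div d) (J div d) (I mod d) (J mod d)
        * expectation (\<lambda>\<omega>. z (J div d) \<omega> * z (J mod d) \<omega>))"
    by (rule sum_div_mod[symmetric])
  also have "\<dots> = (Kmat (season n) *\<^sub>v mom z) $ I"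
    using I by (simp add: Kmat_def mom_def scalar_prod_def lessThan_atLeast0)
  finally show "mom (step n z) $ I = (Kmat (season n) *\<^sub>v mom z) $ I" .
qed (simp add: mom_def Kmat_def)

lemma period_mat_carrier: "period_mat \<in> carrier_mat (d * d) (d * d)"
  unfolding period_mat_def by (rule mat_prod_carrier) auto

lemma mom_carrier: "mom z \<in> carrier_vec (d * d)"
  unfolding mom_def by simp

lemma adapted_T: "adapted (n - int k) z \<Longrightarrow> adapted n (T k n z)"
proof (induction k arbitrary: n)
  case (Suc k)
  then have "adapted (n - 1) (T k (n - 1) z)" by (intro Suc.IH) (simp add: algebra_simps)
  then show ?case by (simp add: adapted_step)
qed simp

lemma T_add: "T (k + l) n z = T k n (T l (n - int k) z)"
  by (induction k arbitrary: n) (simp_all add: algebra_simps)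

lemma mom_T_period:
  assumes z: "adapted (int s * t - int s) z"
  shows "mom (T s (int s * t) z) = period_mat *\<^sub>v mom z"
proof -
  have "mom (T (s - i) (int s * t - int i) z) = mat_prod (d * d) (map (\<lambda>v. Kmat (s - v)) [i..<s]) *\<^sub>v mom z"
    if "i \<le> s" for i
    using that
  proof (induction i rule: inc_induct)
    case base
    show ?case by (simp add: mom_carrier)
  next
    case (step i)
    have "season (int s * t - int i) = s - i"
      using season_eq[of "s - i" "t - 1"] step by (simp add: algebra_simps of_nat_diff)
    moreover have "adapted (int s * t - int i - 1) (T (s - Suc i) (int s * t - int (Suc i)) z)"
    proof -
      have "int s * t - int (Suc i) - int (s - Suc i) = int s * t - int s" using step by simp
      then have "adapted (int s * t - int (Suc i)) (T (s - Suc i) (int s * t - int (Suc i)) z)"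
        using adapted_T[of "int s * t - int (Suc i)" "s - Suc i" z] z by simp
      then show ?thesis by (simp add: algebra_simps)
    qed
    moreover have "T (s - i) (int s * t - int i) z
        = step (int s * t - int i) (T (s - Suc i) (int s * t - int (Suc i)) z)"
    proof -
      have "T (Suc (s - Suc i)) (int s * t - int i) z
        = step (int s * t - int i) (T (s - Suc i) (int s * t - int i - 1) z)"
        by (rule T.simps(2))
      moreover have "Suc (s - Suc i) = s - i" "int s * t - int i - 1 = int s * t - int (Suc i)"
        using step by auto
      ultimately show ?thesis by (simp only:)
    qed
    ultimately have "mom (T (s - i) (int s * t - int i) z) = Kmat (s - i) *\<^sub>v mom (T (s - Suc i) (int s * t - int (Suc i)) z)"
      using mom_step[of "int s * t - int i" "T (s - Suc i) (int s * t - int (Suc i)) z"]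
      by (simp only:)
    also have "\<dots> = Kmat (s - i) *\<^sub>v (mat_prod (d * d) (map (\<lambda>v. Kmat (s - v)) [Suc i..<s]) *\<^sub>v mom z)"
      using step by simp
    also have "\<dots> = (Kmat (s - i) * mat_prod (d * d) (map (\<lambda>v. Kmat (s - v)) [Suc i..<s])) *\<^sub>v mom z"
      by (rule assoc_mult_mat_vec[symmetric, OF Kmat_carrier mat_prod_carrier mom_carrier]) auto
    also have "\<dots> = mat_prod (d * d) (map (\<lambda>v. Kmat (s - v)) [i..<s]) *\<^sub>v mom z"
      using step by (simp add: upt_conv_Cons)
    finally show ?case .
  qed
  from this[of 0] show ?thesis by (simp add: period_mat_def)
qed

lemma mom_T:
  assumes "adapted (int s * t - int (s * k)) z"
  shows "mom (T (s * k) (int s * t) z) = (period_mat ^\<^sub>m k) *\<^sub>v mom z"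
  using assms
proof (induction k arbitrary: z)
  case 0
  then show ?case using period_mat_carrier mom_carrier[of z] by simp
next
  case (Suc k)
  let ?n = "int s * (t - int k)"
  have z: "adapted (?n - int s) z" using Suc.prems by (simp add: algebra_simps)
  have "T (s * Suc k) (int s * t) z = T (s * k) (int s * t) (T s ?n z)"
    using T_add[of "s * k" s "int s * t" z] by (simp add: algebra_simps)
  moreover have "adapted ?n (T s ?n z)" using adapted_T z by blast
  ultimately have "mom (T (s * Suc k) (int s * t) z) = (period_mat ^\<^sub>m k) *\<^sub>v mom (T s ?n z)"
    using Suc.IH by (simp add: algebra_simps)
  also have "\<dots> = (period_mat ^\<^sub>m k) *\<^sub>v (period_mat *\<^sub>v mom z)"
    using mom_T_period[OF z] by simp
  also have "\<dots> = (period_mat ^\<^sub>m Suc k) *\<^sub>v mom z"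
    using assoc_mult_mat_vec[OF pow_carrier_mat[OF period_mat_carrier, of k] period_mat_carrier mom_carrier[of z]] by simp
  finally show ?case .
qed

section \<open>Contraction of the second moments\<close>

lemma V_nonneg: "V z \<ge> 0"
  unfolding V_def by (intro sum_nonneg) simp

lemma mom_le_V:
  assumes z: "adapted n z" and i: "i < d" and j: "j < d"
  shows "\<bar>expectation (\<lambda>\<omega>. z i \<omega> * z j \<omega>)\<bar> \<le> V z"
proof -
  have le: "expectation (\<lambda>\<omega>. (z m \<omega>)\<^sup>2) \<le> V z" if "m < d" for m
    unfolding V_def using that by (intro member_le_sum) auto
  have int: "integrable M (\<lambda>\<omega>. (z m \<omega>)\<^sup>2)" if "m < d" for m
    using z that unfolding adapted_def by blast
  have "\<bar>expectation (\<lambda>\<omega>. z i \<omega> * z j \<omega>)\<bar> \<le> expectation (\<lambda>\<omega>. \<bar>z i \<omega> * z j \<omega>\<bar>)"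
    by (rule integral_abs_bound)
  also have "\<dots> \<le> expectation (\<lambda>\<omega>. ((z i \<omega>)\<^sup>2 + (z j \<omega>)\<^sup>2) / 2)"
  proof (rule integral_mono)
    show "\<bar>z i \<omega> * z j \<omega>\<bar> \<le> ((z i \<omega>)\<^sup>2 + (z j \<omega>)\<^sup>2) / 2" for \<omega>
      using sum_squares_bound[of "\<bar>z i \<omega>\<bar>" "\<bar>z j \<omega>\<bar>"] by (simp add: abs_mult)
  qed (use adapted_integrable[OF z i j] int i j in auto)
  also have "\<dots> = (expectation (\<lambda>\<omega>. (z i \<omega>)\<^sup>2) + expectation (\<lambda>\<omega>. (z j \<omega>)\<^sup>2)) / 2"
    using int[OF i] int[OF j] by simp
  also have "\<dots> \<le> V z" using le[OF i] le[OF j] by simp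
  finally show ?thesis .
qed

text \<open>A bound, uniform over the seasons, for the growth of \<open>V\<close> in a single step; it serves for the
  incomplete periods at the two ends of a time window.\<close>

definition Ksum :: real where
  "Ksum = (\<Sum>v\<in>{1..s}. \<Sum>i<d. \<Sum>j<d. \<Sum>l<d. K v i j i l)"

definition D :: real where "D = max 1 Ksum"

lemma V_step:
  assumes z: "adapted (n - 1) z"
  shows "V (step n z) \<le> D * V z"
proof -
  let ?v = "season n"
  have "V (step n z) = (\<Sum>i<d. \<Sum>j<d. \<Sum>l<d. K ?v i j i l * expectation (\<lambda>\<omega>. z j \<omega> * z l \<omega>))"
    using has_bochner_integral_integral_eq[OF step_products[OF z]]
    by (simp add: V_def power2_eq_square)
  also have "\<dots> \<le> (\<Sum>i<d. \<Sum>j<d. \<Sum>l<d. K ?v i j i l * V z)"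
    using mom_le_V[OF z] K_nonneg[OF season_in]
    by (intro sum_mono mult_left_mono) (auto simp: abs_le_iff)
  also have "\<dots> = (\<Sum>i<d. \<Sum>j<d. \<Sum>l<d. K ?v i j i l) * V z"
    by (simp add: sum_distrib_right)
  also have "\<dots> \<le> Ksum * V z"
    unfolding Ksum_def using season_in[of n] V_nonneg
    by (intro mult_right_mono member_le_sum[of ?v "{1..s}" "\<lambda>v. \<Sum>i<d. \<Sum>j<d. \<Sum>l<d. K v i j i l"])
      (auto intro!: sum_nonneg K_nonneg)
  also have "\<dots> \<le> D * V z"
    unfolding D_def using V_nonneg by (intro mult_right_mono) auto
  finally show ?thesis .
qed

lemma V_T: "adapted (n - int k) z \<Longrightarrow> V (T k n z) \<le> D ^ k * V z"
proof (induction k arbitrary: n)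
  case (Suc k)
  then have z: "adapted (n - 1 - int k) z" by (simp add: algebra_simps)
  have "V (T (Suc k) n z) \<le> D * V (T k (n - 1) z)"
    using V_step[OF adapted_T[OF z]] by simp
  also have "\<dots> \<le> D * (D ^ k * V z)"
    using Suc.IH[OF z] by (intro mult_left_mono) (auto simp: D_def)
  finally show ?case by simp
qed simp

lemma V_T_periods:
  assumes z: "adapted (int s * t - int (s * k)) z"
    and c: "\<And>I J. I < d * d \<Longrightarrow> J < d * d \<Longrightarrow> \<bar>(period_mat ^\<^sub>m k) $$ (I, J)\<bar> \<le> c"
  shows "V (T (s * k) (int s * t) z) \<le> real d * (real (d * d) * c) * V z"
proof -
  have dim: "dim_row (period_mat ^\<^sub>m k) = d * d" "dim_col (period_mat ^\<^sub>m k) = d * d"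
    using period_mat_carrier by auto
  have "expectation (\<lambda>\<omega>. (T (s * k) (int s * t) z i \<omega>)\<^sup>2) \<le> real (d * d) * c * V z" if i: "i < d" for i
  proof -
    note idx = square_index[OF i i]
    have "expectation (\<lambda>\<omega>. (T (s * k) (int s * t) z i \<omega>)\<^sup>2) = mom (T (s * k) (int s * t) z) $ (i * d + i)"
      unfolding mom_def power2_eq_square by (simp only: index_vec[OF idx(1)] idx(2,3))
    also have "\<dots> = (\<Sum>J<d * d. (period_mat ^\<^sub>m k) $$ (i * d + i, J) * mom z $ J)"
      using idx(1) dim mom_carrier[of z] unfolding mom_T[OF z]
      by (simp add: scalar_prod_def lessThan_atLeast0 del: pow_mat_dim)
    also have "\<dots> \<le> (\<Sum>J<d * d. c * V z)"
    proof (rule sum_mono)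
      fix J assume "J \<in> {..<d * d}"
      then have J: "J < d * d" by simp
      have "(period_mat ^\<^sub>m k) $$ (i * d + i, J) * mom z $ J \<le> \<bar>(period_mat ^\<^sub>m k) $$ (i * d + i, J)\<bar> * \<bar>mom z $ J\<bar>"
        by (metis abs_ge_self abs_mult)
      also have "\<dots> \<le> c * V z"
        using c[OF idx(1) J] mom_le_V[OF z] div_mod_less[OF J] J
        by (intro mult_mono) (auto simp: mom_def)
      finally show "(period_mat ^\<^sub>m k) $$ (i * d + i, J) * mom z $ J \<le> c * V z" .
    qed
    also have "\<dots> = real (d * d) * c * V z" by simp
    finally show ?thesis .
  qed
  then have "V (T (s * k) (int s * t) z) \<le> (\<Sum>i<d. real (d * d) * c * V z)"
    unfolding V_def by (intro sum_mono) auto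
  then show ?thesis by (simp add: mult_ac)
qed

lemma contraction:
  assumes "real_spectral_radius period_mat < 1"
  shows "\<exists>L. s dvd L \<and> (\<forall>n z. adapted (n - int L) z \<longrightarrow> V (T L n z) \<le> V z / 4)"
proof -
  have "d * d > 0" using p by simp
  then obtain c r where c: "c \<ge> 0" and r: "0 < r" "r < 1"
    and pow: "\<And>k i j. i < d * d \<Longrightarrow> j < d * d \<Longrightarrow> \<bar>(period_mat ^\<^sub>m k) $$ (i, j)\<bar> \<le> c * r ^ k"
    using real_spectral_radius_less_1_bound[OF period_mat_carrier _ assms] by blast
  let ?C = "D ^ s * (real d * (real (d * d) * c))"
  have "(\<lambda>k. ?C * r ^ k) \<longlonglongrightarrow> ?C * 0"
    using r by (intro tendsto_intros LIMSEQ_realpow_zero) auto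
  then have "eventually (\<lambda>k. ?C * r ^ k < 1 / 4) sequentially"
    by (intro order_tendstoD) auto
  then obtain k where k: "?C * r ^ k < 1 / 4" by (auto simp: eventually_sequentially)
  show ?thesis
  proof (intro exI[of _ "s * k + s"] conjI allI impI)
    show "s dvd s * k + s" by simp
    fix n z assume z: "adapted (n - int (s * k + s)) z"
    \<comment> \<open>The window of length \<open>s k + s\<close> ending at \<open>n\<close> consists of \<open>a\<close> steps, then \<open>k\<close> full periods, then
      \<open>s - a\<close> further steps.\<close>
    define t where "t = n div int s"
    define a where "a = nat (n mod int s)"
    have a: "a \<le> s" "n = int s * t + int a"
      using s unfolding t_def a_def by (auto simp: nat_le_iff less_imp_le)
    let ?u = "T (s - a) (int s * t - int (s * k)) z"
    have "int s * t - int (s * k) - int (s - a) = n - int (s * k + s)" using a by (simp add: of_nat_diff)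
    then have z': "adapted (int s * t - int (s * k) - int (s - a)) z" using z by (simp only:)
    have u: "adapted (int s * t - int (s * k)) ?u" by (rule adapted_T[OF z'])
    have w: "adapted (n - int a) (T (s * k) (int s * t) ?u)"
      using adapted_T[OF u] a by simp
    have eq: "T (s * k + s) n z = T a n (T (s * k) (int s * t) ?u)"
    proof -
      have "s * k + s = a + (s * k + (s - a))" using a by simp
      then have "T (s * k + s) n z = T a n (T (s * k) (n - int a) (T (s - a) (n - int a - int (s * k)) z))"
        by (simp only: T_add)
      moreover have "n - int a = int s * t" using a by simp
      ultimately show ?thesis by (simp only:)
    qed
    have "V (T (s * k + s) n z) \<le> D ^ a * V (T (s * k) (int s * t) ?u)"
      unfolding eq by (rule V_T[OF w])
    also have "\<dots> \<le> D ^ a * (real d * (real (d * d) * (c * r ^ k)) * V ?u)"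
      using pow by (intro mult_left_mono V_T_periods[OF u]) (auto simp: D_def)
    also have "\<dots> \<le> D ^ a * (real d * (real (d * d) * (c * r ^ k)) * (D ^ (s - a) * V z))"
      using c r by (intro mult_left_mono V_T[OF z']) (auto simp: D_def)
    also have "\<dots> = D ^ (a + (s - a)) * (real d * (real (d * d) * (c * r ^ k)) * V z)"
      unfolding power_add by (simp only: mult_ac)
    also have "\<dots> = ?C * r ^ k * V z" using a by (simp add: mult_ac)
    also have "\<dots> \<le> 1 / 4 * V z" using k V_nonneg by (intro mult_right_mono) auto
    finally show "V (T (s * k + s) n z) \<le> V z / 4" by simp
  qed
qed

lemma V_add:
  assumes x: "adapted n x" and y: "adapted m y"
  shows "V (\<lambda>i \<omega>. x i \<omega> + y i \<omega>) \<le> 2 * V x + 2 * V y"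
proof -
  have "expectation (\<lambda>\<omega>. (x i \<omega> + y i \<omega>)\<^sup>2)
      \<le> 2 * expectation (\<lambda>\<omega>. (x i \<omega>)\<^sup>2) + 2 * expectation (\<lambda>\<omega>. (y i \<omega>)\<^sup>2)" if i: "i < d" for i
  proof -
    have int: "integrable M (\<lambda>\<omega>. 2 * (x i \<omega>)\<^sup>2 + 2 * (y i \<omega>)\<^sup>2)"
      and [measurable]: "x i \<in> borel_measurable M" "y i \<in> borel_measurable M"
      using x y i eps_algebra_measurable unfolding adapted_def by auto
    have le: "(x i \<omega> + y i \<omega>)\<^sup>2 \<le> 2 * (x i \<omega>)\<^sup>2 + 2 * (y i \<omega>)\<^sup>2" for \<omega>
      using zero_le_power2[of "x i \<omega> - y i \<omega>"] by (simp add: power2_eq_square algebra_simps)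
    have "integrable M (\<lambda>\<omega>. (x i \<omega> + y i \<omega>)\<^sup>2)"
      by (rule Bochner_Integration.integrable_bound[OF int]) (use le in auto)
    then have "expectation (\<lambda>\<omega>. (x i \<omega> + y i \<omega>)\<^sup>2) \<le> expectation (\<lambda>\<omega>. 2 * (x i \<omega>)\<^sup>2 + 2 * (y i \<omega>)\<^sup>2)"
      using int le by (intro integral_mono) auto
    also have "\<dots> = 2 * expectation (\<lambda>\<omega>. (x i \<omega>)\<^sup>2) + 2 * expectation (\<lambda>\<omega>. (y i \<omega>)\<^sup>2)"
      using x y i unfolding adapted_def by simp
    finally show ?thesis .
  qed
  then have "V (\<lambda>i \<omega>. x i \<omega> + y i \<omega>)
      \<le> (\<Sum>i<d. 2 * expectation (\<lambda>\<omega>. (x i \<omega>)\<^sup>2) + 2 * expectation (\<lambda>\<omega>. (y i \<omega>)\<^sup>2))"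
    unfolding V_def by (intro sum_mono) auto
  then show ?thesis by (simp add: V_def sum.distrib sum_distrib_left)
qed

lemma adapted_add:
  assumes x: "adapted n x" and y: "adapted n y"
  shows "adapted n (\<lambda>i \<omega>. x i \<omega> + y i \<omega>)"
  unfolding adapted_def
proof (intro allI impI conjI)
  fix i assume i: "i < d"
  then have [measurable]: "x i \<in> borel_measurable (eps_algebra {..n})" "y i \<in> borel_measurable (eps_algebra {..n})"
    and int: "integrable M (\<lambda>\<omega>. 2 * (x i \<omega>)\<^sup>2 + 2 * (y i \<omega>)\<^sup>2)"
    using x y unfolding adapted_def by auto
  show m: "(\<lambda>\<omega>. x i \<omega> + y i \<omega>) \<in> borel_measurable (eps_algebra {..n})" by measurable
  have "(\<lambda>\<omega>. (x i \<omega> + y i \<omega>)\<^sup>2) \<in> borel_measurable M"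
    using eps_algebra_measurable[OF m] by measurable
  moreover have "(x i \<omega> + y i \<omega>)\<^sup>2 \<le> 2 * (x i \<omega>)\<^sup>2 + 2 * (y i \<omega>)\<^sup>2" for \<omega>
    using zero_le_power2[of "x i \<omega> - y i \<omega>"] by (simp add: power2_eq_square algebra_simps)
  ultimately show "integrable M (\<lambda>\<omega>. (x i \<omega> + y i \<omega>)\<^sup>2)"
    by (intro Bochner_Integration.integrable_bound[OF int]) auto
qed

lemma offset_square: "has_bochner_integral M (\<lambda>\<omega>. (offset n i \<omega>)\<^sup>2)
   (if i = 0 then (\<alpha>0 (season n))\<^sup>2 * \<kappa> else if i = p then (\<alpha>0 (season n))\<^sup>2 else 0)"
  using affine_products[of "if i = 0 then \<alpha>0 (season n) else 0" n "if i \<noteq> 0 \<and> i = p then \<alpha>0 (season n) else 0"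
     "if i = 0 then \<alpha>0 (season n) else 0" "if i \<noteq> 0 \<and> i = p then \<alpha>0 (season n) else 0"] p
  by (auto simp: offset_def power2_eq_square split: if_splits)

lemma adapted_offset: "adapted n (offset n)"
  using offset_measurable[of n "{..n}"] offset_square unfolding adapted_def
  by (auto simp: has_bochner_integral_iff)

lemma V_offset_bounded: "\<exists>C. \<forall>n. V (offset n) \<le> C"
proof (intro exI allI)
  fix n
  let ?A = "\<Sum>v\<in>{1..s}. (\<alpha>0 v)\<^sup>2"
  have A: "(\<alpha>0 (season n))\<^sup>2 \<le> ?A" using season_in[of n] by (intro member_le_sum) auto
  have "expectation (\<lambda>\<omega>. (offset n i \<omega>)\<^sup>2) \<le> ?A * \<kappa>" for i
  proof -
    have "expectation (\<lambda>\<omega>. (offset n i \<omega>)\<^sup>2) \<le> (\<alpha>0 (season n))\<^sup>2 * \<kappa>"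
      using has_bochner_integral_integral_eq[OF offset_square[of n i]] kappa_ge_1
        mult_left_mono[of 1 \<kappa> "(\<alpha>0 (season n))\<^sup>2"] by (auto simp: split: if_splits)
    also have "\<dots> \<le> ?A * \<kappa>" using A kappa_ge_1 by (intro mult_right_mono) auto
    finally show ?thesis .
  qed
  then have "V (offset n) \<le> (\<Sum>i<d. ?A * \<kappa>)" unfolding V_def by (intro sum_mono)
  then show "V (offset n) \<le> real d * (?A * \<kappa>)" by simp
qed

lemma adapted_0: "adapted n (\<lambda>i \<omega>. 0)"
  unfolding adapted_def by auto

lemma adapted_S: "adapted n (S k n)"
proof (induction k arbitrary: n)
  case 0
  show ?case using adapted_0 by simp
next
  case (Suc k)
  show ?case using adapted_add[OF adapted_step[OF Suc.IH] adapted_offset] by simp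
qed

lemma V_S_bounded: "\<exists>C. \<forall>n. V (S k n) \<le> C"
proof (induction k)
  case 0
  show ?case by (simp add: V_def) blast
next
  case (Suc k)
  then obtain C where C: "\<And>n. V (S k n) \<le> C" by blast
  obtain B where B: "\<And>n. V (offset n) \<le> B" using V_offset_bounded by blast
  have "V (S (Suc k) n) \<le> 2 * (D * C) + 2 * B" for n
  proof -
    have "V (S (Suc k) n) \<le> 2 * V (step n (S k (n - 1))) + 2 * V (offset n)"
      using V_add[OF adapted_step[OF adapted_S] adapted_offset] by simp
    moreover have "V (step n (S k (n - 1))) \<le> D * V (S k (n - 1))"
      by (rule V_step[OF adapted_S])
    moreover have "D * V (S k (n - 1)) \<le> D * C"
      using C by (intro mult_left_mono) (auto simp: D_def)
    ultimately show ?thesis using B[of n] by linarith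
  qed
  then show ?case by blast
qed

lemma step_add: "step n (\<lambda>i \<omega>. x i \<omega> + y i \<omega>) i \<omega> = step n x i \<omega> + step n y i \<omega>"
  unfolding step_def by (simp add: distrib_left sum.distrib)

lemma S_add: "S (k + l) n i \<omega> = S k n i \<omega> + T k n (S l (n - int k)) i \<omega>"
proof (induction k arbitrary: n i \<omega>)
  case (Suc k)
  have "S (k + l) (n - 1) = (\<lambda>i \<omega>. S k (n - 1) i \<omega> + T k (n - 1) (S l (n - 1 - int k)) i \<omega>)"
    using Suc.IH by blast
  then show ?case by (simp add: step_add algebra_simps)
qed simp

text \<open>With \<open>V (S L n) \<le> C\<close>, the bound \<open>4 C\<close> is preserved by adding \<open>L\<close> steps: \<open>2 C + 2 (4 C) / 4 = 4 C\<close>.\<close>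

lemma V_S_multiples_bounded:
  assumes contr: "\<And>n z. adapted (n - int L) z \<Longrightarrow> V (T L n z) \<le> V z / 4"
  shows "\<exists>C. \<forall>k n. V (S (L * k) n) \<le> C"
proof -
  obtain C where C: "\<And>n. V (S L n) \<le> C" using V_S_bounded by blast
  have "V (S (L * k) n) \<le> 4 * C" for k n
  proof (induction k arbitrary: n)
    case 0
    show ?case using order_trans[OF V_nonneg C] by (simp add: V_def)
  next
    case (Suc k)
    have "S (L * Suc k) n = (\<lambda>i \<omega>. S L n i \<omega> + T L n (S (L * k) (n - int L)) i \<omega>)"
      using S_add[of L "L * k" n] by (intro ext) simp
    then have "V (S (L * Suc k) n) \<le> 2 * V (S L n) + 2 * V (T L n (S (L * k) (n - int L)))"
      using V_add[OF adapted_S adapted_T[OF adapted_S]] by simp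
    moreover have "V (T L n (S (L * k) (n - int L))) \<le> V (S (L * k) (n - int L)) / 4"
      by (rule contr[OF adapted_S])
    ultimately show ?case using C[of n] Suc.IH[of "n - int L"] by linarith
  qed
  then show ?thesis by blast
qed

text \<open>The constant random vector equal to the \<open>j\<close>-th unit vector. By \<open>T_linear\<close> below, \<open>T k n (unit_state j)\<close>
  is the \<open>j\<close>-th column of the random matrix \<open>T k n\<close>.\<close>

definition unit_state :: "nat \<Rightarrow> nat \<Rightarrow> 'a \<Rightarrow> real" where
  "unit_state j i \<omega> = (if i = j then 1 else 0)"

lemma adapted_unit_state: "adapted n (unit_state j)"
  unfolding adapted_def unit_state_def[abs_def] by auto

lemma V_unit_state: "j < d \<Longrightarrow> V (unit_state j) = 1"
proof -
  assume "j < d"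
  have "V (unit_state j) = (\<Sum>i<d. if i = j then 1 else 0)"
    unfolding V_def unit_state_def by (intro sum.cong) (auto simp: prob_space)
  then show ?thesis using \<open>j < d\<close> by simp
qed

lemma V_T_unit_state:
  assumes contr: "\<And>n z. adapted (n - int L) z \<Longrightarrow> V (T L n z) \<le> V z / 4" and j: "j < d"
  shows "V (T (L * k) n (unit_state j)) \<le> (1 / 4) ^ k"
proof (induction k arbitrary: n)
  case 0
  show ?case using V_unit_state[OF j] by simp
next
  case (Suc k)
  have "T (L * Suc k) n (unit_state j) = T L n (T (L * k) (n - int L) (unit_state j))"
    using T_add[of L "L * k" n "unit_state j"] by simp
  then show ?case
    using contr[OF adapted_T[OF adapted_unit_state], of n "L * k" j] Suc.IH[of "n - int L"] by simp
qed

lemma T_linear: "i < d \<Longrightarrow> T k n z i \<omega> = (\<Sum>j<d. T k n (unit_state j) i \<omega> * z j \<omega>)"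
proof (induction k arbitrary: n i)
  case 0
  have "(\<Sum>j<d. unit_state j i \<omega> * z j \<omega>) = (\<Sum>j<d. if i = j then z j \<omega> else 0)"
    unfolding unit_state_def by (intro sum.cong) auto
  then show ?case using 0 by simp
next
  case (Suc k)
  have "T (Suc k) n z i \<omega> = (\<Sum>m<d. phi n i m \<omega> * (\<Sum>j<d. T k (n - 1) (unit_state j) m \<omega> * z j \<omega>))"
    using Suc.IH by (simp add: step_def)
  also have "\<dots> = (\<Sum>j<d. (\<Sum>m<d. phi n i m \<omega> * T k (n - 1) (unit_state j) m \<omega>) * z j \<omega>)"
    unfolding sum_distrib_left sum_distrib_right mult.assoc by (rule sum.swap)
  finally show ?case by (simp add: step_def)
qed

section \<open>Lower bounds for the partial sums\<close>

text \<open>Nonnegativity of all coordinates at a given sample point.\<close>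

definition nonneg :: "(nat \<Rightarrow> 'a \<Rightarrow> real) \<Rightarrow> 'a \<Rightarrow> bool" where
  "nonneg z \<omega> \<longleftrightarrow> (\<forall>i<d. z i \<omega> \<ge> 0)"

lemma nonneg_step: "nonneg z \<omega> \<Longrightarrow> nonneg (step n z) \<omega>"
  unfolding nonneg_def step_def using phi_nonneg by (auto intro!: sum_nonneg)

lemma nonneg_T: "nonneg z \<omega> \<Longrightarrow> nonneg (T k n z) \<omega>"
  by (induction k arbitrary: n) (auto intro: nonneg_step)

lemma nonneg_S: "nonneg (S k n) \<omega>"
proof (induction k arbitrary: n)
  case (Suc k)
  then show ?case using nonneg_step[OF Suc, of n] offset_nonneg by (auto simp: nonneg_def)
qed (simp add: nonneg_def)

text \<open>The subdiagonal ones of \<open>\<phi>\<^sub>n\<close> shift coordinates.\<close>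

lemma step_ge_shift:
  assumes z: "nonneg z \<omega>" and i: "Suc i < d" "Suc i \<noteq> p"
  shows "step n z (Suc i) \<omega> \<ge> z i \<omega>"
proof -
  have "phi n (Suc i) i \<omega> * z i \<omega> \<le> step n z (Suc i) \<omega>"
    unfolding step_def using z i phi_nonneg
    by (intro member_le_sum) (auto simp: nonneg_def)
  moreover have "phi n (Suc i) i \<omega> = 1" using i by (simp add: phi_def phi1_def phi0_def)
  ultimately show ?thesis by simp
qed

text \<open>The smallest of the finitely many values of \<open>\<alpha>\<^sub>0\<close>.\<close>

definition alpha_min :: real where "alpha_min = Min (\<alpha>0 ` {1..s})"

lemma alpha_min: "alpha_min > 0" "v \<in> {1..s} \<Longrightarrow> alpha_min \<le> \<alpha>0 v"
proof -
  have "finite (\<alpha>0 ` {1..s})" "\<alpha>0 ` {1..s} \<noteq> {}" using s by auto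
  then show "alpha_min > 0" "v \<in> {1..s} \<Longrightarrow> alpha_min \<le> \<alpha>0 v"
    unfolding alpha_min_def using \<alpha>0 by (auto simp: Min_gr_iff)
qed

text \<open>Up to the factor \<open>alpha_min\<close>, a lower bound for every partial sum of at least \<open>d\<close> steps. Coordinate
  \<open>i < p\<close> stands for \<open>x\<^sup>2\<close> at time \<open>n - i\<close>, which is at least \<open>\<alpha>\<^sub>0 \<epsilon>\<^sup>2\<close>; the others stand for volatilities,
  which are at least \<open>\<alpha>\<^sub>0\<close>.\<close>

definition lower_state :: "int \<Rightarrow> nat \<Rightarrow> 'a \<Rightarrow> real" where
  "lower_state n i \<omega> = (if i < p then (\<epsilon> (n - int i) \<omega>)\<^sup>2 else 1)"

lemma S_ge_y_part:
  "i < p \<Longrightarrow> i < k \<Longrightarrow> S k n i \<omega> \<ge> alpha_min * (\<epsilon> (n - int i) \<omega>)\<^sup>2"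
proof (induction i arbitrary: k n)
  case 0
  then obtain k' where k: "k = Suc k'" by (cases k) auto
  have "step n (S k' (n - 1)) 0 \<omega> \<ge> 0" using nonneg_step[OF nonneg_S] p by (auto simp: nonneg_def)
  moreover have "offset n 0 \<omega> \<ge> alpha_min * (\<epsilon> n \<omega>)\<^sup>2"
    using alpha_min(2)[OF season_in] by (simp add: offset_def mult_right_mono)
  ultimately show ?case by (simp add: k)
next
  case (Suc i)
  then obtain k' where k: "k = Suc k'" by (cases k) auto
  have "alpha_min * (\<epsilon> (n - 1 - int i) \<omega>)\<^sup>2 \<le> S k' (n - 1) i \<omega>" using Suc k by simp
  also have "\<dots> \<le> step n (S k' (n - 1)) (Suc i) \<omega>" using Suc.prems by (intro step_ge_shift nonneg_S) auto
  finally show ?case using offset_nonneg[of n "Suc i" \<omega>] by (simp add: k algebra_simps)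
qed

lemma S_ge_h_part:
  "i < q \<Longrightarrow> i < k \<Longrightarrow> S k n (p + i) \<omega> \<ge> alpha_min"
proof (induction i arbitrary: k n)
  case 0
  then obtain k' where k: "k = Suc k'" by (cases k) auto
  have "step n (S k' (n - 1)) p \<omega> \<ge> 0" using nonneg_step[OF nonneg_S] q by (auto simp: nonneg_def)
  moreover have "offset n p \<omega> \<ge> alpha_min" using alpha_min(2)[OF season_in] p by (simp add: offset_def)
  ultimately show ?case by (simp add: k)
next
  case (Suc i)
  then obtain k' where k: "k = Suc k'" by (cases k) auto
  have "alpha_min \<le> S k' (n - 1) (p + i) \<omega>" using Suc k by simp
  also have "\<dots> \<le> step n (S k' (n - 1)) (Suc (p + i)) \<omega>" using Suc.prems by (intro step_ge_shift nonneg_S) auto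
  finally show ?case using offset_nonneg[of n "Suc (p + i)" \<omega>] by (simp add: k)
qed

lemma S_ge_lower_state:
  assumes "d \<le> k" "i < d"
  shows "S k n i \<omega> \<ge> alpha_min * lower_state n i \<omega>"
proof (cases "i < p")
  case True
  then show ?thesis using S_ge_y_part[of i k n \<omega>] assms by (simp add: lower_state_def)
next
  case False
  then obtain j where "i = p + j" using le_Suc_ex[of p i] by auto
  then show ?thesis using S_ge_h_part[of j k n \<omega>] assms by (simp add: lower_state_def)
qed

text \<open>At different times the two factors are independent with mean 1; at equal times the value is \<open>\<kappa>\<close>.\<close>

lemma eta_product:
  "\<exists>c\<ge>1. has_bochner_integral M (\<lambda>\<omega>. (\<epsilon> m \<omega>)\<^sup>2 * (\<epsilon> m' \<omega>)\<^sup>2) c"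
proof -
  have less: "has_bochner_integral M (\<lambda>\<omega>. (\<epsilon> m \<omega>)\<^sup>2 * (\<epsilon> m' \<omega>)\<^sup>2) 1" if "m' < m" for m m'
  proof -
    have [measurable]: "\<epsilon> m \<in> borel_measurable (eps_algebra {m})" "\<epsilon> m' \<in> borel_measurable (eps_algebra {..<m})"
      using that by (auto intro: eps_measurable_algebra)
    have "has_bochner_integral M (\<lambda>\<omega>. (\<epsilon> m \<omega>)\<^sup>2 * (\<epsilon> m' \<omega>)\<^sup>2) (1 * expectation (\<lambda>\<omega>. (\<epsilon> m' \<omega>)\<^sup>2))"
      using var_eps by (intro expectation_mult_independent) (measurable, auto simp: has_bochner_integral_iff)
    then show ?thesis using var_eps[of m'] by (simp add: has_bochner_integral_iff)
  qed
  consider "m' < m" | "m < m'" | "m = m'" by linarith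
  then show ?thesis
  proof cases
    case 1
    then show ?thesis using less by auto
  next
    case 2
    then show ?thesis using less[of m m'] by (auto simp: mult.commute)
  next
    case 3
    have "has_bochner_integral M (\<lambda>\<omega>. (\<epsilon> m \<omega>)\<^sup>2 * (\<epsilon> m' \<omega>)\<^sup>2) \<kappa>"
      using eps4[of m] 3 by (simp add: power2_eq_square power4_eq_xxxx mult.assoc)
    then show ?thesis using kappa_ge_1 by blast
  qed
qed

lemma lower_state_product:
  "\<exists>c\<ge>1. has_bochner_integral M (\<lambda>\<omega>. lower_state n i \<omega> * lower_state n j \<omega>) c"
proof -
  have one: "has_bochner_integral M (\<lambda>\<omega>. 1) (1::real)"
    by (simp add: has_bochner_integral_iff prob_space)
  show ?thesis
    using eta_product[of "n - int i" "n - int j"] one var_eps[of "n - int i"] var_eps[of "n - int j"]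
    unfolding lower_state_def by (cases "i < p"; cases "j < p") auto
qed

lemma mom_S_ge:
  assumes k: "d \<le> k" and I: "I < d * d"
  shows "mom (S k n) $ I \<ge> alpha_min\<^sup>2"
proof -
  note less = div_mod_less[OF I]
  obtain c where c: "c \<ge> 1"
    "has_bochner_integral M (\<lambda>\<omega>. lower_state n (I div d) \<omega> * lower_state n (I mod d) \<omega>) c"
    using lower_state_product by blast
  have "alpha_min\<^sup>2 \<le> alpha_min\<^sup>2 * c" using c(1) alpha_min(1) by simp
  also have "\<dots> = expectation (\<lambda>\<omega>. alpha_min\<^sup>2 * (lower_state n (I div d) \<omega> * lower_state n (I mod d) \<omega>))"
    using c(2) by (simp add: has_bochner_integral_iff)
  also have "\<dots> \<le> expectation (\<lambda>\<omega>. S k n (I div d) \<omega> * S k n (I mod d) \<omega>)"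
  proof (rule integral_mono)
    fix \<omega>
    have "(alpha_min * lower_state n (I div d) \<omega>) * (alpha_min * lower_state n (I mod d) \<omega>)
        \<le> S k n (I div d) \<omega> * S k n (I mod d) \<omega>"
      using less alpha_min(1) nonneg_S[of k n \<omega>] S_ge_lower_state[OF k]
      by (intro mult_mono) (auto simp: nonneg_def lower_state_def)
    then show "alpha_min\<^sup>2 * (lower_state n (I div d) \<omega> * lower_state n (I mod d) \<omega>)
        \<le> S k n (I div d) \<omega> * S k n (I mod d) \<omega>"
      by (simp add: power2_eq_square mult_ac)
  qed (use c(2) adapted_integrable[OF adapted_S less] in \<open>auto simp: has_bochner_integral_iff\<close>)
  finally show ?thesis using I by (simp add: mom_def)
qed

text \<open>The mixed products are nonnegative and can be dropped.\<close>

lemma mom_add_ge: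
  assumes x: "adapted n x" "\<And>\<omega>. nonneg x \<omega>" and z: "adapted n z" "\<And>\<omega>. nonneg z \<omega>" and I: "I < d * d"
  shows "mom (\<lambda>i \<omega>. x i \<omega> + z i \<omega>) $ I \<ge> mom x $ I + mom z $ I"
proof -
  note less = div_mod_less[OF I]
  have "mom x $ I + mom z $ I
    = expectation (\<lambda>\<omega>. x (I div d) \<omega> * x (I mod d) \<omega> + z (I div d) \<omega> * z (I mod d) \<omega>)"
    using I adapted_integrable[OF x(1) less] adapted_integrable[OF z(1) less] by (simp add: mom_def)
  also have "\<dots> \<le> expectation (\<lambda>\<omega>. (x (I div d) \<omega> + z (I div d) \<omega>) * (x (I mod d) \<omega> + z (I mod d) \<omega>))"
  proof (rule integral_mono)
    show "x (I div d) \<omega> * x (I mod d) \<omega> + z (I div d) \<omega> * z (I mod d) \<omega>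
       \<le> (x (I div d) \<omega> + z (I div d) \<omega>) * (x (I mod d) \<omega> + z (I mod d) \<omega>)" for \<omega>
      using x(2)[of \<omega>] z(2)[of \<omega>] less by (simp add: nonneg_def algebra_simps)
  qed (use adapted_integrable[OF x(1) less] adapted_integrable[OF z(1) less]
      adapted_integrable[OF adapted_add[OF x(1) z(1)] less] in auto)
  finally show ?thesis using I by (simp add: mom_def)
qed

lemma period_mat_nonneg: "I < d * d \<Longrightarrow> J < d * d \<Longrightarrow> period_mat $$ (I, J) \<ge> 0"
proof -
  have K: "Kmat v $$ (I, J) \<ge> 0" if "v \<in> {1..s}" "I < d * d" "J < d * d" for v I J
    using that div_mod_less[OF that(3)] K_nonneg[OF that(1)] by (simp add: Kmat_def)
  have prods: "mat_prod (d * d) (map Kmat vs) $$ (I, J) \<ge> 0" if "set vs \<subseteq> {1..s}" "I < d * d" "J < d * d" for vs I J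
    using that
  proof (induction vs arbitrary: I J)
    case (Cons v vs)
    have "mat_prod (d * d) (map Kmat vs) \<in> carrier_mat (d * d) (d * d)"
      by (rule mat_prod_carrier) auto
    then have "dim_row (mat_prod (d * d) (map Kmat vs)) = d * d" "dim_col (mat_prod (d * d) (map Kmat vs)) = d * d"
      "dim_row (Kmat v) = d * d" "dim_col (Kmat v) = d * d"
      using Kmat_carrier[of v] by blast+
    then have "mat_prod (d * d) (map Kmat (v # vs)) $$ (I, J)
        = (\<Sum>m<d * d. Kmat v $$ (I, m) * mat_prod (d * d) (map Kmat vs) $$ (m, J))"
      using Cons.prems by (simp add: scalar_prod_def lessThan_atLeast0)
    also have "\<dots> \<ge> 0"
      using Cons by (intro sum_nonneg mult_nonneg_nonneg K Cons.IH) auto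
    finally show ?case .
  qed simp
  have eq: "period_mat = mat_prod (d * d) (map Kmat (map (\<lambda>v. s - v) [0..<s]))"
    unfolding period_mat_def by (simp add: comp_def)
  have "set (map (\<lambda>v. s - v) [0..<s]) \<subseteq> {1..s}" by auto
  then show "I < d * d \<Longrightarrow> J < d * d \<Longrightarrow> period_mat $$ (I, J) \<ge> 0"
    unfolding eq by (rule prods)
qed

lemma mom_S_ge_sum:
  assumes I: "I < d * d"
  shows "mom (S (s * d * k) (int s * t)) $ I \<ge> (\<Sum>l<k. alpha_min\<^sup>2 * (\<Sum>J<d * d. (period_mat ^\<^sub>m (d * l)) $$ (I, J)))"
proof (induction k)
  case 0
  show ?case using I by (simp add: mom_def)
next
  case (Suc k)
  let ?n = "int s * t"
  let ?z = "S (s * d) (?n - int (s * d * k))"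
  let ?P = "period_mat ^\<^sub>m (d * k)"
  have "s * d * Suc k = s * d * k + s * d" by simp
  then have S_eq: "S (s * d * Suc k) ?n = (\<lambda>i \<omega>. S (s * d * k) ?n i \<omega> + T (s * d * k) ?n ?z i \<omega>)"
    by (simp only: S_add[abs_def])
  have "mom (S (s * d * Suc k) ?n) $ I \<ge> mom (S (s * d * k) ?n) $ I + mom (T (s * d * k) ?n ?z) $ I"
    unfolding S_eq by (rule mom_add_ge[OF adapted_S nonneg_S adapted_T[OF adapted_S] nonneg_T[OF nonneg_S] I])
  moreover have "mom (T (s * d * k) ?n ?z) $ I \<ge> alpha_min\<^sup>2 * (\<Sum>J<d * d. ?P $$ (I, J))"
  proof -
    have dim: "dim_row ?P = d * d" "dim_col ?P = d * d" using period_mat_carrier by auto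
    have "mom (T (s * d * k) ?n ?z) = ?P *\<^sub>v mom ?z"
      using mom_T[of t "d * k" ?z] adapted_S by (simp only: mult.assoc)
    then have "mom (T (s * d * k) ?n ?z) $ I = (\<Sum>J<d * d. ?P $$ (I, J) * mom ?z $ J)"
      using I dim mom_carrier[of ?z] by (simp add: scalar_prod_def lessThan_atLeast0 del: pow_mat_dim)
    also have "\<dots> \<ge> (\<Sum>J<d * d. ?P $$ (I, J) * alpha_min\<^sup>2)"
    proof (intro sum_mono mult_left_mono)
      fix J assume "J \<in> {..<d * d}"
      then have J: "J < d * d" by simp
      have "d \<le> s * d" using s by simp
      then show "alpha_min\<^sup>2 \<le> mom ?z $ J" using J by (rule mom_S_ge)
      show "0 \<le> ?P $$ (I, J)" using pow_mat_nonneg[OF period_mat_carrier period_mat_nonneg I J] .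
    qed
    finally show ?thesis by (simp add: sum_distrib_left mult.commute)
  qed
  ultimately show ?case using Suc.IH by simp
qed

end

section \<open>Strictly stationary solutions\<close>

text \<open>A strictly stationary solution of the model.\<close>

locale pgarch_stationary = pgarch +
  fixes Y :: "int \<Rightarrow> 'a \<Rightarrow> real vec"
  assumes solution: "pgarch_solution M s p q \<alpha>0 \<alpha> \<beta> \<epsilon> Y"
    and stationary: "strictly_stationary M ((p + q) * s) Y"
begin

text \<open>The state \<open>y\<^sub>n\<close>, cut out of \<open>Y\<^sub>t\<close> for \<open>n = s t + v\<close> as its \<open>v\<close>-th block.\<close>

definition y :: "int \<Rightarrow> nat \<Rightarrow> 'a \<Rightarrow> real" where
  "y n i \<omega> = Y ((n - 1) div int s) \<omega> $ (nat ((n - 1) mod int s) * d + i)"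

lemma y_eq:
  assumes "v \<in> {1..s}"
  shows "y (int s * t + int v) i \<omega> = Y t \<omega> $ ((v - 1) * d + i)"
proof -
  have eq: "int s * t + int v - 1 = (int v - 1) + int s * t" by simp
  have "(int s * t + int v - 1) mod int s = int v - 1"
    unfolding eq using assms by (simp add: mod_pos_pos_trivial)
  moreover have "(int s * t + int v - 1) div int s = t"
    unfolding eq using assms by (simp add: div_pos_pos_trivial)
  moreover have "nat (int v - 1) = v - 1" using assms by simp
  ultimately show ?thesis unfolding y_def by (simp only:)
qed

lemma index_cases:
  obtains t v where "n = int s * t + int v" "v \<in> {1..s}"
proof (rule that)
  have r: "0 \<le> (n - 1) mod int s" "(n - 1) mod int s < int s" using s by simp_all
  have "n - 1 = int s * ((n - 1) div int s) + (n - 1) mod int s" by simp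
  then show "n = int s * ((n - 1) div int s) + int (nat ((n - 1) mod int s) + 1)"
    using r by linarith
  show "nat ((n - 1) mod int s) + 1 \<in> {1..s}" using r by auto
qed

lemma block_index:
  assumes "v \<in> {1..s}" "i < d"
  shows "(v - 1) * d + i < d * s"
proof -
  have "Suc (v - 1) \<le> s" using assms by auto
  have "(v - 1) * d + i < Suc (v - 1) * d" using assms(2) by (simp del: One_nat_def)
  also have "\<dots> \<le> s * d" using \<open>Suc (v - 1) \<le> s\<close> by (rule mult_le_mono1)
  finally show ?thesis by (simp only: mult.commute)
qed

lemma y_measurable: "i < d \<Longrightarrow> y n i \<in> borel_measurable M"
proof -
  assume i: "i < d"
  obtain t v where n: "n = int s * t + int v" "v \<in> {1..s}" by (rule index_cases)
  have "(\<lambda>\<omega>. Y t \<omega> $ ((v - 1) * d + i)) \<in> borel_measurable M"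
    using solution block_index[OF n(2) i] unfolding pgarch_solution_def random_vec_def by blast
  then show ?thesis unfolding n(1) y_eq[OF n(2), abs_def] .
qed

lemma y_nonneg: "AE \<omega> in M. \<forall>i<d. y n i \<omega> \<ge> 0"
proof -
  obtain t v where n: "n = int s * t + int v" "v \<in> {1..s}" by (rule index_cases)
  have "AE \<omega> in M. \<forall>i<d * s. 0 \<le> Y t \<omega> $ i"
    using solution unfolding pgarch_solution_def by blast
  then show ?thesis
    by eventually_elim (use block_index[OF n(2)] in \<open>simp add: n(1) y_eq[OF n(2)]\<close>)
qed

text \<open>The \<open>v\<close>-th block of the block recursion is \<open>season_state\<close>, whose one-step recursion is transferred to \<open>y\<close>.\<close>

lemma y_recursion: "AE \<omega> in M. \<forall>i<d. y n i \<omega> = step n (y (n - 1)) i \<omega> + offset n i \<omega>"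
proof -
  obtain t v where n: "n = int s * t + int v" "v \<in> {1..s}" by (rule index_cases)
  define w where "w = v - 1"
  have w: "v = Suc w" "w < s" using n(2) by (auto simp: w_def)
  have "AE \<omega> in M. Y t \<omega> = pgarch_A s p q \<alpha> \<beta> (pgarch_eta s \<epsilon> t \<omega>) *\<^sub>v Y (t - 1) \<omega>
          + pgarch_B s p q \<alpha>0 \<alpha> \<beta> (pgarch_eta s \<epsilon> t \<omega>)"
    using solution unfolding pgarch_solution_def by blast
  then show ?thesis using AE_space
  proof eventually_elim
    case (elim \<omega>)
    let ?e = "pgarch_eta s \<epsilon> t \<omega>" and ?u = "\<lambda>j. Y (t - 1) \<omega> $ ((s - 1) * d + j)"
    have dim: "dim_vec (Y (t - 1) \<omega>) = d * s"
      using solution elim(2) unfolding pgarch_solution_def random_vec_def by auto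
    \<comment> \<open>The case \<open>v = 0\<close> is the last season of the previous period.\<close>
    have state: "y (int s * t + int v) i \<omega> = season_state ?e ?u v i" if "v \<le> s" "i < d" for v i
    proof (cases v)
      case 0
      have "int s * t + int v = int s * (t - 1) + int s" using 0 by (simp add: algebra_simps)
      moreover have "y (int s * (t - 1) + int s) i \<omega> = ?u i" by (rule y_eq) (use s in auto)
      ultimately show ?thesis using that 0 by (simp only: season_state_0)
    next
      case (Suc w)
      have "y (int s * t + int v) i \<omega> = Y t \<omega> $ (w * d + i)"
        using y_eq[of v t i \<omega>] Suc that by simp
      also have "\<dots> = season_state ?e ?u v i"
        unfolding Suc using pgarch_recursion_entry[of w i "Y (t - 1) \<omega>" ?e] Suc that dim elim(1) by simp
      finally show ?thesis .
    qed
    have n1: "n - 1 = int s * t + int w" using n w by simp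
    show ?case
    proof (intro allI impI)
      fix i assume i: "i < d"
      have "y n i \<omega> = season_state ?e ?u (Suc w) i"
        using state[of v i] n w i by simp
      also have "\<dots> = (\<Sum>j<d. pgarch_phi p q \<alpha> \<beta> v ?e $$ (i, j) * season_state ?e ?u w j) + pgarch_b p q \<alpha>0 v ?e $ i"
        unfolding w(1) by (rule season_state_Suc[OF i])
      also have "(\<Sum>j<d. pgarch_phi p q \<alpha> \<beta> v ?e $$ (i, j) * season_state ?e ?u w j)
          = (\<Sum>j<d. phi n i j \<omega> * y (n - 1) j \<omega>)"
        unfolding n1 using state[of w] w(2) phi_eq[OF n(2) i] n(1) by (intro sum.cong) auto
      also have "pgarch_b p q \<alpha>0 v ?e $ i = offset n i \<omega>" using offset_eq[OF n(2) i] n(1) by simp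
      finally show "y n i \<omega> = step n (y (n - 1)) i \<omega> + offset n i \<omega>" by (simp add: step_def)
    qed
  qed
qed

lemma y_unroll: "AE \<omega> in M. \<forall>i<d. y n i \<omega> = S k n i \<omega> + T k n (y (n - int k)) i \<omega>"
proof (induction k arbitrary: n)
  case (Suc k)
  show ?case using y_recursion[of n] Suc.IH[of "n - 1"]
  proof eventually_elim
    case (elim \<omega>)
    have "step n (y (n - 1)) i \<omega> = step n (\<lambda>i \<omega>. S k (n - 1) i \<omega> + T k (n - 1) (y (n - 1 - int k)) i \<omega>) i \<omega>" for i
      unfolding step_def using elim(2) by (intro sum.cong) auto
    then show ?case using elim(1) by (simp add: step_add algebra_simps)
  qed
qed simp

text \<open>Shifting by whole periods does not change the one-dimensional laws.\<close>

lemma y_law: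
  assumes i: "i < d"
  shows "distr M borel (y (n - int s * h) i) = distr M borel (y n i)"
proof -
  obtain t v where n: "n = int s * t + int v" "v \<in> {1..s}" by (rule index_cases)
  let ?m = "(v - 1) * d + i"
  let ?J = "{t} \<times> {..<d * s}"
  let ?f = "\<lambda>h \<omega>. restrict (\<lambda>(t, i). Y (t + h) \<omega> $ i) ?J"
  have m: "?m < d * s" by (rule block_index[OF n(2) i])
  have Y [measurable]: "(\<lambda>\<omega>. Y t \<omega> $ j) \<in> borel_measurable M" if "j < d * s" for t j
    using solution that unfolding pgarch_solution_def random_vec_def by blast
  have meas: "?f h \<in> measurable M (Pi\<^sub>M ?J (\<lambda>_. borel))" for h
    by (rule measurable_restrict) auto
  have "distr M (Pi\<^sub>M ?J (\<lambda>_. borel)) (?f (- h)) = distr M (Pi\<^sub>M ?J (\<lambda>_. borel)) (?f 0)"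
    using stationary[unfolded strictly_stationary_def, rule_format, of "{t}" "- h"] by simp
  moreover have "distr (distr M (Pi\<^sub>M ?J (\<lambda>_. borel)) (?f h)) borel (\<lambda>g. g (t, ?m))
      = distr M borel (\<lambda>\<omega>. Y (t + h) \<omega> $ ?m)" for h
  proof -
    have proj: "(\<lambda>g. g (t, ?m)) \<in> measurable (Pi\<^sub>M ?J (\<lambda>_. borel :: real measure)) borel"
      using m by (intro measurable_component_singleton) auto
    show ?thesis unfolding distr_distr[OF proj meas] using m by (simp add: comp_def)
  qed
  ultimately have "distr M borel (\<lambda>\<omega>. Y (t + - h) \<omega> $ ?m) = distr M borel (\<lambda>\<omega>. Y (t + 0) \<omega> $ ?m)"
    by metis
  moreover have "y (n - int s * h) i = (\<lambda>\<omega>. Y (t - h) \<omega> $ ?m)" "y n i = (\<lambda>\<omega>. Y t \<omega> $ ?m)"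
    using y_eq[OF n(2), of "t - h" i] y_eq[OF n(2), of t i] n(1) by (auto simp: algebra_simps)
  ultimately show ?thesis by simp
qed

text \<open>The remainder is the sum over \<open>j\<close> of the products \<open>U j k * W j k\<close>, where \<open>U j k\<close> is an entry of the
  random matrix \<open>T (L k) n\<close> and \<open>W j k\<close> is a coordinate of the solution at time \<open>n - L k\<close>.\<close>

lemma y_square_integrable:
  assumes sr: "real_spectral_radius period_mat < 1" and i: "i < d"
  shows "integrable M (\<lambda>\<omega>. (y n i \<omega>)\<^sup>2)"
proof -
  obtain L where L: "s dvd L \<and> (\<forall>n z. adapted (n - int L) z \<longrightarrow> V (T L n z) \<le> V z / 4)"
    using contraction[OF sr] by (rule exE)
  then have contr: "V (T L n z) \<le> V z / 4" if "adapted (n - int L) z" for n z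
    using that by simp
  obtain C where "\<forall>k n. V (S (L * k) n) \<le> C"
    using V_S_multiples_bounded[OF contr] by (rule exE)
  then have C: "V (S (L * k) n) \<le> C" for k n by simp
  have le_V: "expectation (\<lambda>\<omega>. (z i \<omega>)\<^sup>2) \<le> V z" for z
    unfolding V_def using i by (intro member_le_sum) auto
  define U where "U j k = T (L * k) n (unit_state j) i" for j k
  define W where "W j k = y (n - int (L * k)) j" for j k
  have U: "U j k \<in> borel_measurable M" "integrable M (\<lambda>\<omega>. (U j k \<omega>)\<^sup>2)" for j k
    using adapted_T[OF adapted_unit_state, of n "L * k" j] i eps_algebra_measurable
    unfolding U_def adapted_def by blast+
  have W: "W j k \<in> borel_measurable M" if "j < d" for j k
    unfolding W_def using that by (rule y_measurable)
  have small: "(\<lambda>k. prob {\<omega> \<in> space M. \<bar>U j k \<omega> * W j k \<omega>\<bar> > 1 / d}) \<longlonglongrightarrow> 0" if j: "j < d" for j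
  proof (rule product_tendsto_0_in_probability[OF U])
    show "(\<lambda>k. expectation (\<lambda>\<omega>. (U j k \<omega>)\<^sup>2)) \<longlonglongrightarrow> 0"
    proof (rule tendsto_sandwich[where f = "\<lambda>_. 0" and h = "\<lambda>k. (1 / 4) ^ k"])
      show "\<forall>\<^sub>F k in sequentially. expectation (\<lambda>\<omega>. (U j k \<omega>)\<^sup>2) \<le> (1 / 4) ^ k"
        using order_trans[OF le_V V_T_unit_state[OF contr j]] unfolding U_def by simp
      show "(\<lambda>k. (1 / 4 :: real) ^ k) \<longlonglongrightarrow> 0" by (rule LIMSEQ_realpow_zero) auto
    qed auto
    show "distr M borel (W j k) = distr M borel (W j 0)" for k
    proof -
      obtain h where "L = s * h" using conjunct1[OF L] by (rule dvdE)
      then have "W j k = y (n - int s * int (h * k)) j" unfolding W_def by (simp add: mult.assoc)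
      then show ?thesis using y_law[OF j, of n "int (h * k)"] by (simp add: W_def)
    qed
    show "1 / real d > 0" using p by simp
  qed (use W j in auto)
  define R where "R k \<omega> = (\<Sum>j<d. U j k \<omega> * W j k \<omega>)" for k \<omega>
  have UW: "(\<lambda>\<omega>. U j k \<omega> * W j k \<omega>) \<in> borel_measurable M" if "j < d" for j k
    using U W[OF that] by measurable
  have R: "R k \<in> borel_measurable M" for k
    unfolding R_def[abs_def] using UW by (intro borel_measurable_sum) auto
  show ?thesis
  proof (rule square_integrable_limit_in_probability[where S = "\<lambda>k. S (L * k) n i" and R = R])
    show "y n i \<in> borel_measurable M" using i by (rule y_measurable)
    show "integrable M (\<lambda>\<omega>. (S (L * k) n i \<omega>)\<^sup>2)" for k
      using adapted_S i unfolding adapted_def by blast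
    show "expectation (\<lambda>\<omega>. (S (L * k) n i \<omega>)\<^sup>2) \<le> C" for k
      using le_V C by (rule order_trans)
    show "AE \<omega> in M. y n i \<omega> = S (L * k) n i \<omega> + R k \<omega>" for k
      using y_unroll[of n "L * k"]
    proof eventually_elim
      case (elim \<omega>)
      have "T (L * k) n (y (n - int (L * k))) i \<omega> = R k \<omega>"
        unfolding R_def U_def W_def by (rule T_linear[OF i])
      then show ?case using elim i by simp
    qed
    show "(\<lambda>k. prob {\<omega> \<in> space M. \<bar>R k \<omega>\<bar> > 1}) \<longlonglongrightarrow> 0"
    proof (rule tendsto_sandwich[where f = "\<lambda>_. 0"])
      let ?A = "\<lambda>k j. {\<omega> \<in> space M. \<bar>U j k \<omega> * W j k \<omega>\<bar> > 1 / d}"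
      have A: "?A k j \<in> events" if "j < d" for k j
        using UW[OF that, of k] by measurable
      have "prob {\<omega> \<in> space M. \<bar>R k \<omega>\<bar> > 1} \<le> (\<Sum>j<d. prob (?A k j))" for k
      proof -
        have "{\<omega> \<in> space M. \<bar>R k \<omega>\<bar> > 1} \<subseteq> (\<Union>j<d. ?A k j)"
        proof
          fix \<omega> assume \<omega>: "\<omega> \<in> {\<omega> \<in> space M. \<bar>R k \<omega>\<bar> > 1}"
          show "\<omega> \<in> (\<Union>j<d. ?A k j)"
          proof (rule ccontr)
            assume "\<omega> \<notin> (\<Union>j<d. ?A k j)"
            then have "\<bar>U j k \<omega> * W j k \<omega>\<bar> \<le> 1 / d" if "j < d" for j
              using \<omega> that by (auto simp: not_less)
            then have "(\<Sum>j<d. \<bar>U j k \<omega> * W j k \<omega>\<bar>) \<le> (\<Sum>j<d. 1 / d)"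
              by (intro sum_mono) auto
            also have "\<dots> = 1" using p by simp
            finally have "\<bar>R k \<omega>\<bar> \<le> 1" unfolding R_def by (rule order_trans[OF sum_abs])
            then show False using \<omega> by simp
          qed
        qed
        then have "prob {\<omega> \<in> space M. \<bar>R k \<omega>\<bar> > 1} \<le> prob (\<Union>j<d. ?A k j)"
          using A by (intro finite_measure_mono) auto
        also have "\<dots> \<le> (\<Sum>j<d. prob (?A k j))"
          using A by (intro measure_UNION_le) auto
        finally show ?thesis .
      qed
      then show "\<forall>\<^sub>F k in sequentially. prob {\<omega> \<in> space M. \<bar>R k \<omega>\<bar> > 1} \<le> (\<Sum>j<d. prob (?A k j))" by simp
      have "(\<lambda>k. \<Sum>j<d. prob (?A k j)) \<longlonglongrightarrow> (\<Sum>j<d. 0)"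
        using small by (intro tendsto_sum) auto
      then show "(\<lambda>k. \<Sum>j<d. prob (?A k j)) \<longlonglongrightarrow> 0" by simp
    qed auto
  qed (rule R)
qed

lemma Y_in_L2:
  assumes "real_spectral_radius period_mat < 1"
  shows "in_L2 M (d * s) (Y t)"
  unfolding in_L2_def
proof (intro conjI Bochner_Integration.integrable_sum)
  show "random_vec M (d * s) (Y t)" using solution unfolding pgarch_solution_def by blast
  fix m assume "m \<in> {..<d * s}"
  then have m: "m < d * s" by simp
  have "d > 0" using p by simp
  then have i: "m mod d < d" by simp
  have "m div d < s" using m by (simp add: less_mult_imp_div_less mult.commute)
  then have v: "m div d + 1 \<in> {1..s}" by simp
  have "(m div d + 1 - 1) * d + m mod d = m" by (simp only: add_diff_cancel_right' div_mult_mod_eq)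
  then have "y (int s * t + int (m div d + 1)) (m mod d) \<omega> = Y t \<omega> $ m" for \<omega>
    unfolding y_eq[OF v] by (simp only:)
  then show "integrable M (\<lambda>\<omega>. (Y t \<omega> $ m)\<^sup>2)"
    using y_square_integrable[OF assms i, of "int s * t + int (m div d + 1)"] by simp
qed

lemma y_product_integrable:
  assumes fin: "\<And>t. finite_kron_moment M (d * s) (Y t) 2" and ij: "i < d" "j < d"
  shows "integrable M (\<lambda>\<omega>. y n i \<omega> * y n j \<omega>)"
proof -
  obtain t v where n: "n = int s * t + int v" "v \<in> {1..s}" by (rule index_cases)
  let ?N = "d * s" and ?a = "(v - 1) * d + i" and ?b = "(v - 1) * d + j"
  have ab: "?a < ?N" "?b < ?N" using block_index[OF n(2)] ij by auto
  have "integrable M (\<lambda>\<omega>. kron_vec_power (Y t \<omega>) 2 $ (?a * ?N + ?b))"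
    using fin[of t] square_index(1)[OF ab] unfolding finite_kron_moment_def power2_eq_square by blast
  moreover have "kron_vec_power (Y t \<omega>) 2 $ (?a * ?N + ?b) = Y t \<omega> $ ?a * Y t \<omega> $ ?b" if "\<omega> \<in> space M" for \<omega>
    by (rule kron_vec_power_2[OF _ ab])
      (use solution that in \<open>auto simp: pgarch_solution_def random_vec_def\<close>)
  ultimately have "integrable M (\<lambda>\<omega>. Y t \<omega> $ ?a * Y t \<omega> $ ?b)"
    by (subst Bochner_Integration.integrable_cong[OF refl]) (auto intro: sym)
  then show ?thesis unfolding n(1) y_eq[OF n(2)] .
qed

text \<open>The moments of the partial sums are bounded by those of the solution, so the series in the
  lower bound \<open>mom_S_ge_sum\<close> converges.\<close>

lemma spectral_radius_less_1:
  assumes fin: "\<And>t. finite_kron_moment M (d * s) (Y t) 2"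
  shows "real_spectral_radius period_mat < 1"
proof (rule real_spectral_radius_less_1I[OF period_mat_carrier, where f = "\<lambda>l. d * l"])
  show "d * d > 0" using p by simp
  show "(period_mat ^\<^sub>m k) $$ (i, j) \<ge> 0" if "i < d * d" "j < d * d" for k i j
    using pow_mat_nonneg[OF period_mat_carrier period_mat_nonneg that] .
  fix I assume I: "I < d * d"
  note less = div_mod_less[OF I]
  let ?g = "\<lambda>l. alpha_min\<^sup>2 * (\<Sum>J<d * d. (period_mat ^\<^sub>m (d * l)) $$ (I, J))"
  have "summable ?g"
  proof (rule summableI_nonneg_bounded)
    show "0 \<le> ?g l" for l
      using pow_mat_nonneg[OF period_mat_carrier period_mat_nonneg I] by (intro mult_nonneg_nonneg sum_nonneg) auto
    let ?y = "y (int s * 0)"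
    show "(\<Sum>l<k. ?g l) \<le> expectation (\<lambda>\<omega>. ?y (I div d) \<omega> * ?y (I mod d) \<omega>)" for k
    proof -
      let ?S = "S (s * d * k) (int s * 0)"
      have "(\<Sum>l<k. ?g l) \<le> mom ?S $ I" by (rule mom_S_ge_sum[OF I])
      also have "\<dots> = expectation (\<lambda>\<omega>. ?S (I div d) \<omega> * ?S (I mod d) \<omega>)" using I by (simp add: mom_def)
      also have "\<dots> \<le> expectation (\<lambda>\<omega>. ?y (I div d) \<omega> * ?y (I mod d) \<omega>)"
      proof (rule integral_mono_AE)
        show "AE \<omega> in M. ?S (I div d) \<omega> * ?S (I mod d) \<omega> \<le> ?y (I div d) \<omega> * ?y (I mod d) \<omega>"
          using y_unroll[of "int s * 0" "s * d * k"] y_nonneg[of "int s * 0 - int (s * d * k)"]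
        proof eventually_elim
          case (elim \<omega>)
          have "nonneg (T (s * d * k) (int s * 0) (y (int s * 0 - int (s * d * k)))) \<omega>"
            using elim(2) by (intro nonneg_T) (simp add: nonneg_def)
          then have "?S i \<omega> \<le> ?y i \<omega>" if "i < d" for i
            using elim(1) that by (simp add: nonneg_def)
          moreover have "nonneg ?S \<omega>" by (rule nonneg_S)
          ultimately show ?case
            using less by (intro mult_mono') (auto simp: nonneg_def)
        qed
      qed (use adapted_integrable[OF adapted_S less] y_product_integrable[OF fin less] in auto)
      finally show ?thesis .
    qed
  qed
  then have "(\<lambda>l. ?g l / alpha_min\<^sup>2) \<longlonglongrightarrow> 0 / alpha_min\<^sup>2"
    using alpha_min(1) by (intro tendsto_divide summable_LIMSEQ_zero tendsto_const) auto
  then show "(\<lambda>l. \<Sum>J<d * d. (period_mat ^\<^sub>m (d * l)) $$ (I, J)) \<longlonglongrightarrow> 0"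
    using alpha_min(1) by simp
qed

end

section \<open>Existence of second moments\<close>

theorem theorem4:
  fixes M :: "'a measure" and s p q :: nat
    and \<alpha>0 :: "nat \<Rightarrow> real" and \<alpha> \<beta> :: "nat \<Rightarrow> nat \<Rightarrow> real"
    and \<epsilon> :: "int \<Rightarrow> 'a \<Rightarrow> real" and t0 :: int
  assumes "prob_space M"
    and "s \<ge> 1" and "p \<ge> 1" and "q \<ge> 1"
    and "\<And>v. v \<in> {1..s} \<Longrightarrow> \<alpha>0 v > 0"
    and "\<And>i v. i \<in> {1..p} \<Longrightarrow> v \<in> {1..s} \<Longrightarrow> \<alpha> i v \<ge> 0"
    and "\<And>j v. j \<in> {1..q} \<Longrightarrow> v \<in> {1..s} \<Longrightarrow> \<beta> j v \<ge> 0"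
    and "prob_space.indep_vars M (\<lambda>_. borel) \<epsilon> UNIV"
    and "\<And>t u. distr M borel (\<epsilon> t) = distr M borel (\<epsilon> u)"
    and "\<And>t. has_bochner_integral M (\<epsilon> t) 0"
    and "\<And>t. has_bochner_integral M (\<lambda>\<omega>. \<epsilon> t \<omega> ^ 2) 1"
    and "\<And>t. has_bochner_integral M (\<lambda>\<omega>. \<epsilon> t \<omega> ^ 3) 0"
    and "\<And>t. kappa M (\<epsilon> t) 2 < \<infinity>"
  shows "(real_spectral_radius (pgarch_moment_mat M s p q \<alpha> \<beta> \<epsilon> 2 t0) < 1 \<longrightarrow>
            (\<forall>Y. pgarch_solution M s p q \<alpha>0 \<alpha> \<beta> \<epsilon> Y \<and> strictly_stationary M ((p + q) * s) Y \<longrightarrow>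
               (\<forall>t. in_L2 M ((p + q) * s) (Y t)))) \<and>
         (real_spectral_radius (pgarch_moment_mat M s p q \<alpha> \<beta> \<epsilon> 2 t0) \<ge> 1 \<longrightarrow>
            \<not> (\<exists>Y. pgarch_solution M s p q \<alpha>0 \<alpha> \<beta> \<epsilon> Y \<and> strictly_stationary M ((p + q) * s) Y \<and>
               (\<forall>t. finite_kron_moment M ((p + q) * s) (Y t) 2)))"
proof -
  interpret pgarch M s p q \<alpha>0 \<alpha> \<beta> \<epsilon>
    using assms by (intro pgarch.intro pgarch_axioms.intro) blast+
  have Y: "pgarch_stationary M s p q \<alpha>0 \<alpha> \<beta> \<epsilon> Y"
    if "pgarch_solution M s p q \<alpha>0 \<alpha> \<beta> \<epsilon> Y" "strictly_stationary M ((p + q) * s) Y" for Y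
    using that by (intro pgarch_stationary.intro pgarch_axioms pgarch_stationary_axioms.intro)
  show ?thesis
    unfolding moment_mat_eq
  proof (intro conjI impI allI notI)
    fix Y t
    assume "real_spectral_radius period_mat < 1"
      and "pgarch_solution M s p q \<alpha>0 \<alpha> \<beta> \<epsilon> Y \<and> strictly_stationary M ((p + q) * s) Y"
    then show "in_L2 M ((p + q) * s) (Y t)"
      using pgarch_stationary.Y_in_L2[OF Y] by blast
  next
    assume ge: "1 \<le> real_spectral_radius period_mat"
      and "\<exists>Y. pgarch_solution M s p q \<alpha>0 \<alpha> \<beta> \<epsilon> Y \<and> strictly_stationary M ((p + q) * s) Y \<and>
             (\<forall>t. finite_kron_moment M ((p + q) * s) (Y t) 2)"
    then obtain Y where "pgarch_stationary M s p q \<alpha>0 \<alpha> \<beta> \<epsilon> Y"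
      and "\<forall>t. finite_kron_moment M ((p + q) * s) (Y t) 2"
      using Y by blast
    then have "real_spectral_radius period_mat < 1"
      using pgarch_stationary.spectral_radius_less_1 by blast
    then show False using ge by simp
  qed
qed

end
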